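(* Let $\alpha$ be a Young tableau with $k$ boxes and $r$ rows, and let $\operatorname{Seg}^\alpha:(\mathbb{P}\mathcal{H})^{\times r}_\circ\to\mathbb{P}(\mathcal{H}^\alpha)$ be the $\alpha$-Segre map $(\rho_{x_1},\dots,\rho_{x_r})\mapsto\rho_{\pi^\alpha(x_{\alpha(1)}\otimes\cdots\otimes x_{\alpha(k)})}$ (well defined). Then a pure $\alpha$-state $\rho\in\mathbb{P}(\mathcal{H}^\alpha)$ is an entangled $\alpha$-state if and only if it is not in the range of $\operatorname{Seg}^\alpha$. Moreover, the set $\mathcal{S}(\mathcal{H}^\alpha)$ of simple (non-entangled) mixed $\alpha$-states equals the convex hull of the range of $\operatorname{Seg}^\alpha$ (pure states identified with rank-one orthogonal projectors), and the entangled mixed $\alpha$-states are exactly the elements of $\mathcal{D}(\mathcal{H}^\alpha)\setminus\mathcal{S}(\mathcal{H}^\alpha)$.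
   Context: $\mathcal{H}$ is a finite-dimensional complex Hilbert space; $\rho_x=|x\rangle\langle x|/\|x\|^2$ for $x\ne0$; $\mathcal{D}(V)$ is the set of density operators (positive semidefinite, trace one) on a Hilbert space $V$. $(\mathbb{P}\mathcal{H})^{\times r}_\circ=\{(\rho_{x_1},\dots,\rho_{x_r}):x_1\wedge\cdots\wedge x_r\neq0\}$. Young tableau $\alpha$: partition $k=\lambda_1+\cdots+\lambda_r$, $\lambda_1\ge\cdots\ge\lambda_r\ge1$, left-aligned rows of $\lambda_i$ boxes numbered bijectively by $1,\dots,k$; $\alpha(i)$ is the row of box $i$. $S_k$ acts on $\mathcal{H}^{\otimes k}$ by permuting tensor factors. $P_\alpha,Q_\alpha$: row- and column-preserving subgroups of $S_k$; $c_\alpha=\big(\sum_{\tau\in Q_\alpha}(-1)^\tau\tau\big)\circ\big(\sum_{\sigma\in P_\alpha}\sigma\big)$; $\pi^\alpha=c_\alpha/\mu(\alpha)$ where $c_\alpha^2=\mu(\alpha)c_\alpha$, $\mu(\alpha)\ne0$; $\mathcal{H}^\alpha=\pi^\alpha(\mathcal{H}^{\otimes k})$, an irreducible subrepresentation of the diagonal action of $U(\mathcal{H})$ on $\mathcal{H}^{\otimes k}$. An $\alpha$-simple tensor is a nonzero highest-weight vector in $\mathcal{H}^\alpha$ relative to some choice of maximal torus and Borel subgroup of $U(\mathcal{H})$. A pure $\alpha$-state is $\rho_v$ with $0\ne v\in\mathcal{H}^\alpha$; it is simple if $v$ is $\alpha$-simple and entangled otherwise. A mixed state on $\mathcal{H}^\alpha$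 is simple if it is a convex combination of simple pure $\alpha$-states, and entangled otherwise. *)

theory Defs
  imports Complex_Main "HOL-Combinatorics.Permutations"
begin

text \<open>Conventions.  The Hilbert space is \<open>H = 'n \<Rightarrow> complex\<close> for a finite type \<open>'n\<close>
  (standard orthonormal basis indexed by \<open>'n\<close>).  The \<open>k\<close> boxes of a Young tableau are the
  elements of a finite type \<open>'k\<close> (so \<open>k = CARD('k)\<close>); the tableau is given by the row
  and column of each box.  A tensor in \<open>H^{\<otimes>k}\<close> is its coefficient function
  \<open>('k \<Rightarrow> 'n) \<Rightarrow> complex\<close>; an operator on \<open>H^{\<otimes>k}\<close> is its matrix (kernel)
  \<open>('k \<Rightarrow> 'n) \<Rightarrow> ('k \<Rightarrow> 'n) \<Rightarrow> complex\<close>.\<close>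

type_synonym ('k, 'n) tensor = "('k \<Rightarrow> 'n) \<Rightarrow> complex"
type_synonym ('k, 'n) kernel = "('k \<Rightarrow> 'n) \<Rightarrow> ('k \<Rightarrow> 'n) \<Rightarrow> complex"

definition young_tableau :: "nat \<Rightarrow> (nat \<Rightarrow> nat) \<Rightarrow> ('k::finite \<Rightarrow> nat) \<Rightarrow> ('k \<Rightarrow> nat) \<Rightarrow> bool" where
  "young_tableau r lam row col \<longleftrightarrow>
     (\<forall>i<r. 1 \<le> lam i) \<and> (\<forall>i j. i \<le> j \<longrightarrow> j < r \<longrightarrow> lam j \<le> lam i) \<and>
     bij_betw (\<lambda>b. (row b, col b)) UNIV {(i, j). i < r \<and> j < lam i}"

definition row_group :: "('k::finite \<Rightarrow> nat) \<Rightarrow> ('k \<Rightarrow> 'k) set" where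
  "row_group row = {p. p permutes UNIV \<and> (\<forall>b. row (p b) = row b)}"

definition col_group :: "('k::finite \<Rightarrow> nat) \<Rightarrow> ('k \<Rightarrow> 'k) set" where
  "col_group col = {q. q permutes UNIV \<and> (\<forall>b. col (q b) = col b)}"

text \<open>Action of a permutation \<open>\<sigma>\<close> on \<open>H^{\<otimes>k}\<close> by permuting tensor factors
  (the factor in slot \<open>b\<close> is moved to slot \<open>\<sigma> b\<close>).\<close>
definition perm_act :: "('k \<Rightarrow> 'k) \<Rightarrow> ('k, 'n) tensor \<Rightarrow> ('k, 'n) tensor" where
  "perm_act \<sigma> T = (\<lambda>f. T (f \<circ> \<sigma>))"

definition young_c :: "('k::finite \<Rightarrow> nat) \<Rightarrow> ('k \<Rightarrow> nat) \<Rightarrow> ('k, 'n) tensor \<Rightarrow> ('k, 'n) tensor" where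
  "young_c row col T =
     (\<lambda>f. \<Sum>q\<in>col_group col. of_int (sign q) * perm_act q (\<lambda>g. \<Sum>p\<in>row_group row. perm_act p T g) f)"

text \<open>\<open>\<mu>(\<alpha>)\<close>: the scalar with \<open>c_\<alpha>^2 = \<mu>(\<alpha>) c_\<alpha>\<close> in the group algebra \<open>\<complex>[S_k]\<close>,
  i.e. the coefficient of the identity in \<open>c_\<alpha>^2\<close> (the coefficient of the identity
  in \<open>c_\<alpha>\<close> being 1).\<close>
definition young_mu :: "('k::finite \<Rightarrow> nat) \<Rightarrow> ('k \<Rightarrow> nat) \<Rightarrow> int" where
  "young_mu row col =
     (\<Sum>q\<in>col_group col. \<Sum>p\<in>row_group row. \<Sum>q'\<in>col_group col. \<Sum>p'\<in>row_group row.
        if q \<circ> p \<circ> q' \<circ> p' = id then sign q * sign q' else 0)"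

definition young_pi :: "('k::finite \<Rightarrow> nat) \<Rightarrow> ('k \<Rightarrow> nat) \<Rightarrow> ('k, 'n) tensor \<Rightarrow> ('k, 'n) tensor" where
  "young_pi row col T = (\<lambda>f. young_c row col T f / of_int (young_mu row col))"

definition H_alpha :: "('k::finite \<Rightarrow> nat) \<Rightarrow> ('k \<Rightarrow> nat) \<Rightarrow> ('k, 'n) tensor set" where
  "H_alpha row col = range (young_pi row col)"

definition proj_state :: "('a::finite \<Rightarrow> complex) \<Rightarrow> 'a \<Rightarrow> 'a \<Rightarrow> complex" where
  "proj_state v = (\<lambda>a b. v a * cnj (v b) / of_real (\<Sum>c\<in>UNIV. (cmod (v c))\<^sup>2))"

definition row_tensor :: "('k \<Rightarrow> nat) \<Rightarrow> (nat \<Rightarrow> 'n \<Rightarrow> complex) \<Rightarrow> ('k::finite, 'n) tensor" where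
  "row_tensor row x = (\<lambda>f. \<Prod>b\<in>UNIV. x (row b) (f b))"

definition wedge_nonzero :: "nat \<Rightarrow> (nat \<Rightarrow> 'n \<Rightarrow> complex) \<Rightarrow> bool" where
  "wedge_nonzero r x \<longleftrightarrow>
     (\<forall>c::nat \<Rightarrow> complex. (\<forall>j. (\<Sum>i<r. c i * x i j) = 0) \<longrightarrow> (\<forall>i<r. c i = 0))"

definition seg_range :: "nat \<Rightarrow> ('k::finite \<Rightarrow> nat) \<Rightarrow> ('k \<Rightarrow> nat) \<Rightarrow> ('k, 'n::finite) kernel set" where
  "seg_range r row col =
     {proj_state (young_pi row col (row_tensor row x)) | x. wedge_nonzero r x}"

definition unitary_mat :: "('n::finite \<Rightarrow> 'n \<Rightarrow> complex) \<Rightarrow> bool" where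
  "unitary_mat U \<longleftrightarrow>
     (\<forall>i j. (\<Sum>l\<in>UNIV. U i l * cnj (U j l)) = (if i = j then 1 else 0)) \<and>
     (\<forall>i j. (\<Sum>l\<in>UNIV. cnj (U l i) * U l j) = (if i = j then 1 else 0))"

definition invertible_mat :: "('n::finite \<Rightarrow> 'n \<Rightarrow> complex) \<Rightarrow> bool" where
  "invertible_mat g \<longleftrightarrow> (\<exists>h. \<forall>i j.
     (\<Sum>l\<in>UNIV. g i l * h l j) = (if i = j then 1 else 0) \<and>
     (\<Sum>l\<in>UNIV. h i l * g l j) = (if i = j then 1 else 0))"

definition tensor_power_act :: "('n::finite \<Rightarrow> 'n \<Rightarrow> complex) \<Rightarrow> ('k::finite, 'n) tensor \<Rightarrow> ('k, 'n) tensor" where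
  "tensor_power_act g T = (\<lambda>f. \<Sum>h\<in>UNIV. (\<Prod>b\<in>UNIV. g (f b) (h b)) * T h)"

text \<open>Borel subgroup of the complexification \<open>GL(H)\<close> of \<open>U(H)\<close> containing the
  (complexified) maximal torus of matrices diagonal in the orthonormal basis given by the
  columns of the unitary \<open>U\<close>: invertible matrices that are upper triangular in that basis,
  the basis being ordered by the injective \<open>idx\<close>.\<close>
definition borel_elem :: "('n::finite \<Rightarrow> 'n \<Rightarrow> complex) \<Rightarrow> ('n \<Rightarrow> nat) \<Rightarrow> ('n \<Rightarrow> 'n \<Rightarrow> complex) \<Rightarrow> bool" where
  "borel_elem U idx g \<longleftrightarrow> invertible_mat g \<and>
     (\<forall>i j. idx j < idx i \<longrightarrow> (\<Sum>a\<in>UNIV. \<Sum>c\<in>UNIV. cnj (U a i) * g a c * U c j) = 0)"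

text \<open>\<open>\<alpha>\<close>-simple tensor: nonzero highest-weight vector of \<open>H^\<alpha>\<close> for some maximal torus
  and Borel subgroup, i.e. a nonzero vector of \<open>H^\<alpha>\<close> spanning a line stable under that
  Borel subgroup.\<close>
definition alpha_simple :: "('k::finite \<Rightarrow> nat) \<Rightarrow> ('k \<Rightarrow> nat) \<Rightarrow> ('k, 'n::finite) tensor \<Rightarrow> bool" where
  "alpha_simple row col v \<longleftrightarrow> v \<in> H_alpha row col \<and> v \<noteq> (\<lambda>_. 0) \<and>
     (\<exists>U idx. unitary_mat U \<and> inj idx \<and>
        (\<forall>g. borel_elem U idx g \<longrightarrow> (\<exists>c. tensor_power_act g v = (\<lambda>f. c * v f))))"

definition pure_alpha_state :: "('k::finite \<Rightarrow> nat) \<Rightarrow> ('k \<Rightarrow> nat) \<Rightarrow> ('k, 'n::finite) kernel \<Rightarrow> bool" where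
  "pure_alpha_state row col \<rho> \<longleftrightarrow> (\<exists>v\<in>H_alpha row col. v \<noteq> (\<lambda>_. 0) \<and> \<rho> = proj_state v)"

definition simple_pure_state :: "('k::finite \<Rightarrow> nat) \<Rightarrow> ('k \<Rightarrow> nat) \<Rightarrow> ('k, 'n::finite) kernel \<Rightarrow> bool" where
  "simple_pure_state row col \<rho> \<longleftrightarrow> (\<exists>v. alpha_simple row col v \<and> \<rho> = proj_state v)"

definition entangled_pure_state :: "('k::finite \<Rightarrow> nat) \<Rightarrow> ('k \<Rightarrow> nat) \<Rightarrow> ('k, 'n::finite) kernel \<Rightarrow> bool" where
  "entangled_pure_state row col \<rho> \<longleftrightarrow> pure_alpha_state row col \<rho> \<and> \<not> simple_pure_state row col \<rho>"

definition conv_ops :: "('a \<Rightarrow> 'a \<Rightarrow> complex) set \<Rightarrow> ('a \<Rightarrow> 'a \<Rightarrow> complex) set" where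
  "conv_ops A = {K. \<exists>(m::nat) (t::nat \<Rightarrow> real) \<rho>.
      (\<forall>i<m. 0 \<le> t i \<and> \<rho> i \<in> A) \<and> (\<Sum>i<m. t i) = 1 \<and>
      K = (\<lambda>a b. \<Sum>i<m. of_real (t i) * \<rho> i a b)}"

text \<open>\<open>\<D>(H^\<alpha>)\<close>: density operators on \<open>H^\<alpha>\<close>, identified with the positive semidefinite
  trace-one operators on \<open>H^{\<otimes>k}\<close> whose range lies in \<open>H^\<alpha>\<close>.\<close>
definition density_alpha :: "('k::finite \<Rightarrow> nat) \<Rightarrow> ('k \<Rightarrow> nat) \<Rightarrow> ('k, 'n::finite) kernel set" where
  "density_alpha row col = {K.
     (\<forall>T::('k, 'n) tensor. Im (\<Sum>a\<in>UNIV. \<Sum>b\<in>UNIV. cnj (T a) * K a b * T b) = 0 \<and>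
                           Re (\<Sum>a\<in>UNIV. \<Sum>b\<in>UNIV. cnj (T a) * K a b * T b) \<ge> 0) \<and>
     (\<Sum>a\<in>UNIV. K a a) = 1 \<and>
     (\<forall>b. (\<lambda>a. K a b) \<in> H_alpha row col)}"

definition simple_mixed :: "('k::finite \<Rightarrow> nat) \<Rightarrow> ('k \<Rightarrow> nat) \<Rightarrow> ('k, 'n::finite) kernel set" where
  "simple_mixed row col =
     {K \<in> density_alpha row col. K \<in> conv_ops {\<rho>. simple_pure_state row col \<rho>}}"

definition entangled_mixed :: "('k::finite \<Rightarrow> nat) \<Rightarrow> ('k \<Rightarrow> nat) \<Rightarrow> ('k, 'n::finite) kernel set" where
  "entangled_mixed row col =
     {K \<in> density_alpha row col. K \<notin> conv_ops {\<rho>. simple_pure_state row col \<rho>}}"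

end

theory Submission
  imports Defs
begin

text \<open>Write \<open>\<pi>\<close> as column antisymmetrization \<open>b\<close> after row symmetrization \<open>a\<close>. Expanding a triangular change of the
  vectors \<open>x\<^sub>1, \<dots>, x\<^sub>r\<close> multilinearly, only the diagonal terms survive column antisymmetrization, so
  \<open>\<pi>\<close> of their row tensor depends, up to a scalar, only on the flag of the \<open>x\<^sub>i\<close>; it therefore spans a line
  stable under the Borel subgroup of a unitary basis obtained from the \<open>x\<^sub>i\<close> by Gram-Schmidt.

  Conversely let \<open>v \<in> H\<^sup>\<alpha>\<close> be nonzero and Borel stable, the basis being the standard one. Then \<open>v\<close> and
  \<open>a v\<close> are killed by the raising operators, and \<open>a v \<noteq> 0\<close>. Row symmetry forces a support element of
  \<open>a v\<close>, hence one of \<open>v\<close>, whose entries in row \<open>i\<close> have index at most \<open>i\<close>; antisymmetry of \<open>v\<close> in the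
  columns makes this element the filling by row numbers. So a highest-weight vector with vanishing
  coefficient at that filling is zero, and \<open>v\<close> is a multiple of \<open>\<pi>\<close> of the row tensor of basis vectors.\<close>

section \<open>Row and column groups\<close>

lemma row_groupD: "p \<in> row_group row \<Longrightarrow> p permutes UNIV \<and> row (p b) = row b"
  by (simp add: row_group_def)

text \<open>Both groups are stabilizers of a labelling of the boxes, so facts about
  \<open>row_group\<close> serve columns as well, with \<open>col\<close> in place of
  \<open>row\<close>.\<close>

lemma col_group_eq_row_group: "col_group = row_group"
  by (rule ext) (simp add: col_group_def row_group_def)

lemma id_in_row_group: "id \<in> row_group row"
  by (simp add: row_group_def permutes_id)

lemma comp_in_row_group: "p \<in> row_group row \<Longrightarrow> p' \<in> row_group row \<Longrightarrow> p \<circ> p' \<in> row_group row"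
  by (simp add: row_group_def permutes_compose)

lemma inv_in_row_group: "p \<in> row_group row \<Longrightarrow> inv p \<in> row_group row"
  unfolding row_group_def by (auto simp: permutes_inv) (metis permutes_inverses(1))

lemma transpose_in_row_group: "row b = row b' \<Longrightarrow> transpose b b' \<in> row_group row"
  by (auto simp: row_group_def permutes_swap_id transpose_def)

lemma row_group_inv_o: "p \<in> row_group row \<Longrightarrow> p \<circ> inv p = id" "p \<in> row_group row \<Longrightarrow> inv p \<circ> p = id"
  using row_groupD permutes_inv_o by blast+

lemma sum_row_group_left:
  assumes "p \<in> row_group row"
  shows "(\<Sum>s\<in>row_group row. F (p \<circ> s)) = (\<Sum>s\<in>row_group row. F s)"
  by (rule sum.reindex_bij_witness[where i="\<lambda>s. inv p \<circ> s" and j="\<lambda>s. p \<circ> s"])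
     (auto simp: assms comp_in_row_group inv_in_row_group o_assoc row_group_inv_o[OF assms])

lemma sum_row_group_right:
  assumes "p \<in> row_group row"
  shows "(\<Sum>s\<in>row_group row. F (s \<circ> p)) = (\<Sum>s\<in>row_group row. F s)"
  by (rule sum.reindex_bij_witness[where i="\<lambda>s. s \<circ> inv p" and j="\<lambda>s. s \<circ> p"])
     (auto simp: assms comp_in_row_group inv_in_row_group comp_assoc row_group_inv_o[OF assms])

lemma sum_row_group_inv:
  "(\<Sum>s\<in>row_group row. F (inv s)) = (\<Sum>s\<in>row_group row. F s)"
  by (rule sum.reindex_bij_witness[where i=inv and j=inv])
     (auto simp: inv_in_row_group dest: row_groupD intro: permutes_inv_inv)

lemma permutation_row_group: "p \<in> row_group row \<Longrightarrow> permutation p"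
  for row :: "'k::finite \<Rightarrow> nat"
  using row_groupD permutation_permutes by fastforce

lemma sign_inv_row_group: "p \<in> row_group row \<Longrightarrow> sign (inv p) = sign p"
  for row :: "'k::finite \<Rightarrow> nat"
  by (simp add: permutation_row_group sign_inverse)

lemma sign_comp_row_group:
  "p \<in> row_group row \<Longrightarrow> p' \<in> row_group row \<Longrightarrow> sign (p \<circ> p') = sign p * sign p'"
  for row :: "'k::finite \<Rightarrow> nat"
  by (meson permutation_row_group sign_compose)

section \<open>The symmetrizers \<open>a\<close> and \<open>b\<close> as operators on
  tensors\<close>

definition rowsym :: "('k::finite \<Rightarrow> nat) \<Rightarrow> ('k, 'n) tensor \<Rightarrow> ('k, 'n) tensor" where
  "rowsym row T = (\<lambda>f. \<Sum>p\<in>row_group row. T (f \<circ> p))"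

definition colsym :: "('k::finite \<Rightarrow> nat) \<Rightarrow> ('k, 'n) tensor \<Rightarrow> ('k, 'n) tensor" where
  "colsym col T = (\<lambda>f. \<Sum>q\<in>row_group col. of_int (sign q) * T (f \<circ> q))"

lemma young_c_eq: "young_c row col T = colsym col (rowsym row T)"
  by (simp add: young_c_def colsym_def rowsym_def perm_act_def col_group_eq_row_group)

lemma young_pi_eq: "young_pi row col T = (\<lambda>f. colsym col (rowsym row T) f / of_int (young_mu row col))"
  by (simp add: young_pi_def young_c_eq)

section \<open>Combinatorics of the boxes of a tableau\<close>

locale tableau =
  fixes r :: nat and lam :: "nat \<Rightarrow> nat" and row col :: "'k::finite \<Rightarrow> nat"
  assumes tab: "young_tableau r lam row col"
begin

lemma box_eqI: "row b = row b' \<Longrightarrow> col b = col b' \<Longrightarrow> b = b'"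
  using tab unfolding young_tableau_def bij_betw_def inj_on_def by blast

lemma row_less: "row b < r" and col_less: "col b < lam (row b)"
proof -
  have "(row b, col b) \<in> {(i, j). i < r \<and> j < lam i}"
    using tab unfolding young_tableau_def bij_betw_def by blast
  then show "row b < r" "col b < lam (row b)" by auto
qed

lemma ex_box: "i < r \<Longrightarrow> j < lam i \<Longrightarrow> \<exists>b. row b = i \<and> col b = j"
proof -
  assume "i < r" "j < lam i"
  then have "(i, j) \<in> (\<lambda>b. (row b, col b)) ` UNIV"
    using tab unfolding young_tableau_def bij_betw_def by blast
  then show ?thesis by auto
qed

text \<open>Row lengths decrease weakly downwards, so a column that reaches some row meets every row
  above it.\<close>

lemma ex_box_above: "i \<le> row b \<Longrightarrow> \<exists>b'. row b' = i \<and> col b' = col b"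
proof -
  assume i: "i \<le> row b"
  have "lam (row b) \<le> lam i"
    using tab i row_less unfolding young_tableau_def by blast
  then show ?thesis using ex_box[of i "col b"] i row_less[of b] col_less[of b] by auto
qed

lemma row_exists: "i < r \<Longrightarrow> \<exists>b. row b = i"
  using ex_box[of i 0] tab unfolding young_tableau_def by fastforce

lemma row_col_group_Int:
  assumes "p \<in> row_group row" "p \<in> row_group col" shows "p = id"
  using assms box_eqI by (intro ext) (auto simp: row_group_def)

text \<open>Induction from the top row: if \<open>\<phi> b\<close> were smaller than
  \<open>row b\<close>, the box of the same column in row \<open>\<phi> b\<close> would already
  carry that value. This kills the off-diagonal terms of triangular expansions and also pins down
  the support of highest-weight vectors.\<close>

lemma column_filling_unique:
  assumes le: "\<And>b. \<phi> b \<le> row b"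
    and inj: "\<And>b b'. b \<noteq> b' \<Longrightarrow> col b = col b' \<Longrightarrow> \<phi> b \<noteq> \<phi> b'"
  shows "\<phi> b = row b"
proof (induction "row b" arbitrary: b rule: less_induct)
  case less
  show ?case
  proof (rule ccontr)
    assume "\<phi> b \<noteq> row b"
    with le[of b] have lt: "\<phi> b < row b" by simp
    then obtain b' where b': "row b' = \<phi> b" "col b' = col b"
      using ex_box_above[of "\<phi> b" b] by auto
    have "\<phi> b' = row b'" using less b' lt by metis
    then show False using inj[of b' b] b' lt by fastforce
  qed
qed

text \<open>With \<open>a = \<Sum>p\<close> over the row group and \<open>b = \<Sum>sign q q\<close> over the column group, \<open>young_mu\<close> is the
  coefficient of the identity in \<open>baba\<close>. As \<open>aa = |P|a\<close> and that coefficient is invariant under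
  cyclic shifts, \<open>|P|\<^sup>2 young_mu\<close> is its value at \<open>(aba)(aba)\<close>, the squared norm of the
  self-adjoint element \<open>aba\<close>, whose own identity coefficient is positive.\<close>
lemma young_mu_pos: "young_mu row col > 0"
proof -
  let ?P = "row_group row" and ?Q = "row_group col"
  define \<phi> where "\<phi> = (\<lambda>(p :: 'k \<Rightarrow> 'k, q :: 'k \<Rightarrow> 'k, p' :: 'k \<Rightarrow> 'k). p \<circ> q \<circ> p')"
  define w where "w = (\<lambda>(p :: 'k \<Rightarrow> 'k, q :: 'k \<Rightarrow> 'k, p' :: 'k \<Rightarrow> 'k). sign q)"
  define X where "X = ?P \<times> ?Q \<times> ?P"
  \<comment> \<open>\<open>Z g\<close> is the coefficient of \<open>g\<close> in the group algebra
    element \<open>aba\<close>.\<close>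
  define Z where "Z g = (\<Sum>x\<in>X. if \<phi> x = g then w x else 0)" for g
  \<comment> \<open>Translation absorbs \<open>s\<close> and \<open>s'\<close> into \<open>p\<close>
    and \<open>p'\<close>. Inverting \<open>t\<close> and moving \<open>p\<close> to the other end
    of the product then gives the condition in \<open>young_mu\<close>.\<close>
  have cancel: "(\<Sum>p\<in>?P. \<Sum>q\<in>?Q. \<Sum>p'\<in>?P. \<Sum>t\<in>?Q.
        if p \<circ> q \<circ> p' = s \<circ> t \<circ> s' then sign q * sign t else 0) = young_mu row col"
    if s: "s \<in> ?P" and s': "s' \<in> ?P" for s s'
  proof -
    have bs: "bij s" "bij s'" using s s' row_groupD permutes_bij by blast+
    have "(\<Sum>p\<in>?P. \<Sum>q\<in>?Q. \<Sum>p'\<in>?P. \<Sum>t\<in>?Q.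
        if p \<circ> q \<circ> p' = s \<circ> t \<circ> s' then sign q * sign t else 0)
      = (\<Sum>p\<in>?P. \<Sum>q\<in>?Q. \<Sum>p'\<in>?P. \<Sum>t\<in>?Q.
        if (s \<circ> p) \<circ> q \<circ> (p' \<circ> s') = s \<circ> t \<circ> s' then sign q * sign t else 0)"
      by (rule trans[OF sum_row_group_left[OF s, symmetric]],
          rule sum.cong[OF refl], rule sum.cong[OF refl], rule sum_row_group_right[OF s', symmetric])
    also have "\<dots> = (\<Sum>p\<in>?P. \<Sum>q\<in>?Q. \<Sum>p'\<in>?P. \<Sum>t\<in>?Q.
        if p \<circ> q \<circ> p' = t then sign q * sign t else 0)"
    proof (intro sum.cong refl if_cong iffI)
      fix p q p' t :: "'k \<Rightarrow> 'k"
      assume "(s \<circ> p) \<circ> q \<circ> (p' \<circ> s') = s \<circ> t \<circ> s'"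
      then have "s (p (q (p' (s' b)))) = s (t (s' b))" for b
        by (metis comp_apply)
      then have "p (q (p' (s' b))) = t (s' b)" for b
        using bs(1) by (metis bij_pointE)
      then show "p \<circ> q \<circ> p' = t"
        using bs(2) by (intro ext) (metis bij_pointE comp_apply)
    qed auto
    also have "\<dots> = (\<Sum>p\<in>?P. \<Sum>q\<in>?Q. \<Sum>p'\<in>?P. \<Sum>t\<in>?Q.
        if p \<circ> q \<circ> p' = inv t then sign q * sign (inv t) else 0)"
      by (rule sum.cong[OF refl], rule sum.cong[OF refl], rule sum.cong[OF refl], rule sum_row_group_inv[symmetric])
    also have "\<dots> = (\<Sum>p\<in>?P. \<Sum>q\<in>?Q. \<Sum>p'\<in>?P. \<Sum>t\<in>?Q.
        if q \<circ> p' \<circ> t \<circ> p = id then sign q * sign t else 0)"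
    proof (intro sum.cong refl if_cong iffI)
      fix p q p' t assume A: "p \<in> ?P" "q \<in> ?Q" "p' \<in> ?P" "t \<in> ?Q"
      then have P: "p permutes UNIV" "t permutes UNIV" using row_groupD by blast+
      show "q \<circ> p' \<circ> t \<circ> p = id" if "p \<circ> q \<circ> p' = inv t"
      proof -
        have "p (q (p' (t (p b)))) = p b" for b
          using that P(2) by (metis comp_apply permutes_inverses(2))
        then show ?thesis using P(1) by (intro ext) (metis comp_apply id_apply permutes_inverses(2))
      qed
      show "p \<circ> q \<circ> p' = inv t" if "q \<circ> p' \<circ> t \<circ> p = id"
      proof
        fix b
        have "q (p' (t (p (inv p (inv t b))))) = inv p (inv t b)"
          using that by (metis comp_apply id_apply)
        then have "q (p' b) = inv p (inv t b)" using P by (simp add: permutes_inverses)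
        then show "(p \<circ> q \<circ> p') b = inv t b" using P by (simp add: permutes_inverses)
      qed
    qed (auto simp: sign_inv_row_group)
    also have "\<dots> = young_mu row col"
      unfolding young_mu_def col_group_eq_row_group
      by (subst sum.swap, rule sum.cong[OF refl], subst sum.swap, rule sum.cong[OF refl],
          subst sum.swap, rule refl)
    finally show ?thesis .
  qed
  have "(\<Sum>g\<in>UNIV. (Z g)\<^sup>2)
      = (\<Sum>g\<in>UNIV. \<Sum>x\<in>X. \<Sum>y\<in>X. if \<phi> x = g then (if \<phi> y = g then w x * w y else 0) else 0)"
    unfolding Z_def power2_eq_square sum_product by (intro sum.cong refl) auto
  also have "\<dots> = (\<Sum>x\<in>X. \<Sum>y\<in>X. \<Sum>g\<in>UNIV. if \<phi> x = g then (if \<phi> y = g then w x * w y else 0) else 0)"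
    by (subst sum.swap, rule sum.cong[OF refl], subst sum.swap, rule refl)
  also have "\<dots> = (\<Sum>x\<in>X. \<Sum>y\<in>X. if \<phi> y = \<phi> x then w x * w y else 0)"
    by simp
  also have "\<dots> = (\<Sum>x\<in>X. \<Sum>y\<in>X. if \<phi> x = \<phi> y then w x * w y else 0)"
    by (intro sum.cong refl) auto
  also have "\<dots> = (\<Sum>y\<in>X. \<Sum>x\<in>X. if \<phi> x = \<phi> y then w x * w y else 0)"
    by (rule sum.swap)
  also have "\<dots> = (\<Sum>s\<in>?P. \<Sum>t\<in>?Q. \<Sum>s'\<in>?P. \<Sum>p\<in>?P. \<Sum>q\<in>?Q. \<Sum>p'\<in>?P.
      if p \<circ> q \<circ> p' = s \<circ> t \<circ> s' then sign q * sign t else 0)"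
    unfolding X_def \<phi>_def w_def sum.cartesian_product' by (simp cong: if_cong)
  \<comment> \<open>The repeated swaps carry the sum over \<open>t\<close> inward past the others,
    which is the order used in \<open>cancel\<close>.\<close>
  also have "\<dots> = (\<Sum>s\<in>?P. \<Sum>s'\<in>?P. \<Sum>p\<in>?P. \<Sum>q\<in>?Q. \<Sum>p'\<in>?P. \<Sum>t\<in>?Q. 
      if p \<circ> q \<circ> p' = s \<circ> t \<circ> s' then sign q * sign t else 0)"
    by (rule sum.cong[OF refl], (rule trans[OF sum.swap], rule sum.cong[OF refl])+, rule refl)
  also have "\<dots> = (\<Sum>s\<in>?P. \<Sum>s'\<in>?P. young_mu row col)"
    by (intro sum.cong refl cancel)
  also have "\<dots> = int (card ?P) ^ 2 * young_mu row col"
    by (simp add: power2_eq_square)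
  finally have eq: "(\<Sum>g\<in>UNIV. (Z g)\<^sup>2) = int (card ?P) ^ 2 * young_mu row col" .
  have "Z id > 0" unfolding Z_def
  proof (rule sum_pos2)
    show "(id, id, id) \<in> X" by (simp add: X_def id_in_row_group)
    show "0 < (if \<phi> (id, id, id) = id then w (id, id, id) else 0)"
      by (simp add: \<phi>_def w_def)
  next
    fix x assume "x \<in> X"
    then obtain p q p' where x: "x = (p, q, p')" and A: "p \<in> ?P" "q \<in> ?Q" "p' \<in> ?P"
      by (auto simp: X_def)
    \<comment> \<open>If the product is \<open>id\<close>, then \<open>q\<close> lies in both groups
      and is itself \<open>id\<close>, so no triple contributes a negative term.\<close>
    have "w x = 1" if "\<phi> x = id"
    proof -
      have "q b = (inv p \<circ> inv p') b" for b
      proof -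
        have "p (q (p' (inv p' b))) = inv p' b"
          using that x by (metis \<phi>_def case_prod_conv comp_apply id_apply)
        then show ?thesis using A row_groupD[of p] row_groupD[of p']
          by (metis comp_apply permutes_inverses)
      qed
      then have "q = inv p \<circ> inv p'" by blast
      then have "q \<in> ?P" using A by (metis comp_in_row_group inv_in_row_group)
      then have "q = id" using A row_col_group_Int by blast
      then show ?thesis by (simp add: w_def x)
    qed
    then show "0 \<le> (if \<phi> x = id then w x else 0)" by simp
  qed simp
  then have "0 < (\<Sum>g\<in>UNIV. (Z g)\<^sup>2)"
    by (intro sum_pos2[of _ id]) auto
  with eq show ?thesis by (simp add: zero_less_mult_iff)
qed

end

section \<open>Symmetrizers\<close>

lemma sum_reindex_perm:
  fixes F :: "('k::finite \<Rightarrow> 'n::finite) \<Rightarrow> 'c::comm_monoid_add"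
  assumes "p permutes (UNIV :: 'k set)"
  shows "(\<Sum>f\<in>UNIV. F (f \<circ> p)) = (\<Sum>f\<in>UNIV. F f)"
  by (rule sum.reindex_bij_witness[where i="\<lambda>f. f \<circ> inv p" and j="\<lambda>f. f \<circ> p"])
     (auto simp: comp_assoc permutes_inv_o[OF assms])

lemma colsym_comp:
  assumes "q \<in> row_group col"
  shows "colsym col T (f \<circ> q) = of_int (sign q) * colsym col T f"
proof -
  have "colsym col T (f \<circ> q) = (\<Sum>s\<in>row_group col. of_int (sign q) * (of_int (sign (q \<circ> s)) * T (f \<circ> (q \<circ> s))))"
    unfolding colsym_def
  proof (rule sum.cong[OF refl])
    fix s assume "s \<in> row_group col"
    then show "of_int (sign s) * T (f \<circ> q \<circ> s) = of_int (sign q) * (of_int (sign (q \<circ> s)) * T (f \<circ> (q \<circ> s)))"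
      by (simp add: sign_comp_row_group[OF assms] comp_assoc flip: mult.assoc of_int_mult)
  qed
  also have "\<dots> = (\<Sum>s\<in>row_group col. of_int (sign q) * (of_int (sign s) * T (f \<circ> s)))"
    by (rule sum_row_group_left[OF assms])
  finally show ?thesis by (simp add: colsym_def sum_distrib_left)
qed

text \<open>The transposition of the two boxes fixes \<open>f\<close> and has sign -1, so the value
  equals its own negative.\<close>

lemma colsym_repeated_index:
  assumes "b \<noteq> b'" "col b = col b'" "f b = f b'"
  shows "colsym col T f = 0"
proof -
  have "f \<circ> transpose b b' = f"
    using assms(3) by (auto simp: transpose_def)
  then have "colsym col T f = - colsym col T f"
    using colsym_comp[OF transpose_in_row_group[OF assms(2)], of T f] assms(1)
    by (simp add: sign_swap_id)
  then show ?thesis by simp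
qed

lemma rowsym_comp: "p \<in> row_group row \<Longrightarrow> rowsym row T (f \<circ> p) = rowsym row T f"
  unfolding rowsym_def comp_assoc by (rule sum_row_group_left)

lemma colsym_add: "colsym col (\<lambda>f. S f + T f) = (\<lambda>f. colsym col S f + colsym col T f)"
  by (simp add: colsym_def distrib_left sum.distrib)

lemma colsym_scale: "colsym col (\<lambda>f. c * T f) = (\<lambda>f. c * colsym col T f)"
  by (simp add: colsym_def sum_distrib_left mult.left_commute)

lemma colsym_sum: "colsym col (\<lambda>f. \<Sum>x\<in>X. c x * S x f) = (\<lambda>f. \<Sum>x\<in>X. c x * colsym col (S x) f)"
proof
  fix f
  show "colsym col (\<lambda>f. \<Sum>x\<in>X. c x * S x f) f = (\<Sum>x\<in>X. c x * colsym col (S x) f)"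
    unfolding colsym_def sum_distrib_left
    by (subst sum.swap) (simp add: mult.left_commute)
qed

lemma rowsym_add: "rowsym row (\<lambda>f. S f + T f) = (\<lambda>f. rowsym row S f + rowsym row T f)"
  by (simp add: rowsym_def sum.distrib)

lemma rowsym_scale: "rowsym row (\<lambda>f. c * T f) = (\<lambda>f. c * rowsym row T f)"
  by (simp add: rowsym_def sum_distrib_left)

lemma young_pi_scale: "young_pi row col (\<lambda>f. c * T f) = (\<lambda>f. c * young_pi row col T f)"
  by (simp add: young_pi_eq rowsym_scale colsym_scale)

lemma young_pi_add: "young_pi row col (\<lambda>f. S f + T f) = (\<lambda>f. young_pi row col S f + young_pi row col T f)"
  by (simp add: young_pi_eq rowsym_add colsym_add add_divide_distrib)

lemma H_alpha_add: "S \<in> H_alpha row col \<Longrightarrow> T \<in> H_alpha row col \<Longrightarrow> (\<lambda>f. S f + T f) \<in> H_alpha row col"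
  unfolding H_alpha_def by (auto simp flip: young_pi_add)

lemma H_alpha_scale: "T \<in> H_alpha row col \<Longrightarrow> (\<lambda>f. c * T f) \<in> H_alpha row col"
  unfolding H_alpha_def by (auto simp flip: young_pi_scale)

lemma H_alpha_zero: "(\<lambda>_. 0) \<in> H_alpha row col"
  using H_alpha_scale[of "young_pi row col (\<lambda>_. 0)" row col 0] by (simp add: H_alpha_def)

lemma H_alpha_sum:
  "(\<And>i. i \<in> I \<Longrightarrow> T i \<in> H_alpha row col) \<Longrightarrow> (\<lambda>f. \<Sum>i\<in>I. T i f) \<in> H_alpha row col"
  by (induction I rule: infinite_finite_induct) (auto simp: H_alpha_zero H_alpha_add)

lemma young_pi_in_H_alpha: "young_pi row col T \<in> H_alpha row col"
  by (simp add: H_alpha_def)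

text \<open>Each box has its own vector: expanding a row tensor multilinearly leaves the class of
  tensors that are constant along rows.\<close>

definition box_tensor :: "('k \<Rightarrow> 'n \<Rightarrow> complex) \<Rightarrow> ('k::finite, 'n) tensor" where
  "box_tensor z = (\<lambda>f. \<Prod>b\<in>UNIV. z b (f b))"

lemma row_tensor_eq_box_tensor: "row_tensor row x = box_tensor (\<lambda>b. x (row b))"
  by (simp add: row_tensor_def box_tensor_def)

lemma box_tensor_comp:
  assumes "p permutes UNIV"
  shows "box_tensor (z \<circ> p) (f \<circ> p) = box_tensor z f"
  using prod.permute[OF assms, of "\<lambda>b. z b (f b)"] by (simp add: box_tensor_def comp_def)

text \<open>A row tensor is already row symmetric, so on it \<open>young_pi\<close> is column
  antisymmetrization up to a scalar.\<close>

lemma rowsym_row_tensor: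
  "rowsym row (row_tensor row x) = (\<lambda>f. of_nat (card (row_group row)) * row_tensor row x f)"
proof
  fix f
  have "row_tensor row x (f \<circ> p) = row_tensor row x f" if "p \<in> row_group row" for p
  proof -
    have "(\<lambda>b. x (row b)) \<circ> p = (\<lambda>b. x (row b))"
      using that by (auto simp: row_group_def)
    then show ?thesis
      using box_tensor_comp[of p "\<lambda>b. x (row b)" f] row_groupD[OF that]
      by (simp add: row_tensor_eq_box_tensor)
  qed
  then show "rowsym row (row_tensor row x) f = of_nat (card (row_group row)) * row_tensor row x f"
    by (simp add: rowsym_def)
qed

lemma young_pi_row_tensor:
  "young_pi row col (row_tensor row x) =
     (\<lambda>f. of_nat (card (row_group row)) / of_int (young_mu row col) * colsym col (row_tensor row x) f)"
  by (simp add: young_pi_eq rowsym_row_tensor colsym_scale)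

text \<open>Counterpart of \<open>colsym_repeated_index\<close> in which the tensor, not the index,
  is invariant under the transposition; hence the translation acts on the right of
  \<open>q\<close>.\<close>

lemma colsym_box_tensor_repeated:
  assumes "b \<noteq> b'" "col b = col b'" "z b = z b'"
  shows "colsym col (box_tensor z) f = 0"
proof -
  let ?t = "transpose b b'"
  have t: "?t \<in> row_group col" using assms(2) by (rule transpose_in_row_group)
  have tz: "z \<circ> ?t = z" using assms(3) by (auto simp: transpose_def)
  have "colsym col (box_tensor z) f
      = (\<Sum>q\<in>row_group col. of_int (sign (q \<circ> ?t)) * box_tensor z (f \<circ> (q \<circ> ?t)))"
    unfolding colsym_def by (rule sum_row_group_right[OF t, symmetric])
  also have "\<dots> = (\<Sum>q\<in>row_group col. - (of_int (sign q) * box_tensor z (f \<circ> q)))"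
  proof (rule sum.cong[OF refl])
    fix q assume q: "q \<in> row_group col"
    have "box_tensor z (f \<circ> (q \<circ> ?t)) = box_tensor z (f \<circ> q)"
      using box_tensor_comp[of ?t z "f \<circ> q"] row_groupD[OF t] tz by (simp add: comp_assoc)
    then show "of_int (sign (q \<circ> ?t)) * box_tensor z (f \<circ> (q \<circ> ?t)) = - (of_int (sign q) * box_tensor z (f \<circ> q))"
      using assms(1) by (simp add: sign_comp_row_group[OF q t] sign_swap_id)
  qed
  also have "\<dots> = - colsym col (box_tensor z) f"
    by (simp add: colsym_def sum_negf)
  finally show ?thesis by simp
qed

section \<open>Row tensors under a triangular change of vectors, and injectivity of row
  symmetrization\<close>

context tableau
begin

text \<open>The expansion runs over fillings \<open>\<phi>\<close> that choose one summand per box,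
  with \<open>\<phi> b\<close> at most \<open>row b\<close>. By \<open>column_filling_unique\<close>
  every filling other than \<open>row\<close> repeats a value in some column, and antisymmetrization
  kills it.\<close>

lemma colsym_row_tensor_triangular:
  assumes y: "\<And>i a. i < r \<Longrightarrow> y i a = (\<Sum>j\<le>i. A i j * x j a)"
  shows "colsym col (row_tensor row y)
    = (\<lambda>f. (\<Prod>b\<in>UNIV. A (row b) (row b)) * colsym col (row_tensor row x) f)"
proof
  fix f
  let ?F = "\<Pi>\<^sub>E b\<in>(UNIV :: 'k set). {..row b}"
  have fin: "finite ?F" by (intro finite_PiE) auto
  have "row_tensor row y = (\<lambda>f. \<Sum>\<phi>\<in>?F. (\<Prod>b\<in>UNIV. A (row b) (\<phi> b)) * box_tensor (\<lambda>b. x (\<phi> b)) f)"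
  proof
    fix f
    have "row_tensor row y f = (\<Prod>b\<in>UNIV. \<Sum>j\<in>{..row b}. A (row b) j * x j (f b))"
      by (simp add: row_tensor_def y row_less)
    also have "\<dots> = (\<Sum>\<phi>\<in>?F. \<Prod>b\<in>UNIV. A (row b) (\<phi> b) * x (\<phi> b) (f b))"
      by (rule prod_sum_PiE) auto
    finally show "row_tensor row y f = (\<Sum>\<phi>\<in>?F. (\<Prod>b\<in>UNIV. A (row b) (\<phi> b)) * box_tensor (\<lambda>b. x (\<phi> b)) f)"
      by (simp add: prod.distrib box_tensor_def)
  qed
  then have "colsym col (row_tensor row y) f
      = (\<Sum>\<phi>\<in>?F. (\<Prod>b\<in>UNIV. A (row b) (\<phi> b)) * colsym col (box_tensor (\<lambda>b. x (\<phi> b))) f)"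
    by (simp add: colsym_sum)
  also have "\<dots> = (\<Sum>\<phi>\<in>?F. if \<phi> = row then (\<Prod>b\<in>UNIV. A (row b) (row b)) * colsym col (row_tensor row x) f else 0)"
  proof (rule sum.cong[OF refl])
    fix \<phi> assume \<phi>: "\<phi> \<in> ?F"
    show "(\<Prod>b\<in>UNIV. A (row b) (\<phi> b)) * colsym col (box_tensor (\<lambda>b. x (\<phi> b))) f =
      (if \<phi> = row then (\<Prod>b\<in>UNIV. A (row b) (row b)) * colsym col (row_tensor row x) f else 0)"
    proof (cases "\<phi> = row")
      case True
      then show ?thesis by (simp add: row_tensor_eq_box_tensor)
    next
      case False
      have "\<phi> b \<le> row b" for b using \<phi> by (auto simp: PiE_def Pi_def)
      then have "\<exists>b b'. b \<noteq> b' \<and> col b = col b' \<and> \<phi> b = \<phi> b'"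
        using False column_filling_unique[of \<phi>] by (metis ext)
      then obtain b b' where "b \<noteq> b'" "col b = col b'" "\<phi> b = \<phi> b'"
        by blast
      then have "colsym col (box_tensor (\<lambda>b. x (\<phi> b))) f = 0"
        by (intro colsym_box_tensor_repeated[of b b']) auto
      then show ?thesis using False by simp
    qed
  qed
  also have "\<dots> = (\<Prod>b\<in>UNIV. A (row b) (row b)) * colsym col (row_tensor row x) f"
  proof -
    have "row \<in> ?F" by (rule PiE_I) auto
    then show ?thesis by (simp add: sum.delta[OF fin])
  qed
  finally show "colsym col (row_tensor row y) f
    = (\<Prod>b\<in>UNIV. A (row b) (row b)) * colsym col (row_tensor row x) f" .
qed

lemma young_pi_row_tensor_triangular:
  assumes "\<And>i a. i < r \<Longrightarrow> y i a = (\<Sum>j\<le>i. A i j * x j a)"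
  shows "young_pi row col (row_tensor row y)
    = (\<lambda>f. (\<Prod>b\<in>UNIV. A (row b) (row b)) * young_pi row col (row_tensor row x) f)"
  by (simp add: young_pi_row_tensor colsym_row_tensor_triangular[of y A x, OF assms] mult.left_commute)

text \<open>If \<open>v = b a T\<close> with the self-adjoint symmetrizers \<open>a\<close>, \<open>b\<close>, then
  \<open>\<langle>v, v\<rangle> = |Q| \<langle>v, a T\<rangle> = |Q| \<langle>a v, T\<rangle>\<close>.\<close>
lemma rowsym_nonzero:
  fixes v :: "('k, 'n::finite) tensor"
  assumes v: "v \<in> H_alpha row col" "v \<noteq> (\<lambda>_. 0)"
  shows "rowsym row v \<noteq> (\<lambda>_. 0)"
proof
  assume u0: "rowsym row v = (\<lambda>_. 0)"
  obtain T0 where T0: "v = young_pi row col T0" using v(1) by (auto simp: H_alpha_def)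
  \<comment> \<open>The scalar in \<open>young_pi\<close> is absorbed into \<open>T\<close>, so that
    \<open>v\<close> is exactly \<open>b a T\<close>.\<close>
  define T where "T = (\<lambda>f. inverse (of_int (young_mu row col)) * T0 f)"
  define w where "w = rowsym row T"
  have vw: "v = colsym col w"
  proof -
    have "colsym col w = (\<lambda>f. inverse (of_int (young_mu row col)) * colsym col (rowsym row T0) f)"
      by (simp add: w_def T_def rowsym_scale colsym_scale)
    then show ?thesis by (simp add: T0 young_pi_eq divide_inverse mult.commute)
  qed
  have "(\<Sum>f\<in>UNIV. cnj (v f) * v f) = (\<Sum>q\<in>row_group col. \<Sum>f\<in>UNIV. cnj (v f) * (of_int (sign q) * w (f \<circ> q)))"
    by (subst (2) vw, subst sum.swap) (simp add: colsym_def sum_distrib_left)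
  also have "\<dots> = (\<Sum>q\<in>row_group col. \<Sum>f\<in>UNIV. cnj (v f) * w f)"
  proof (rule sum.cong[OF refl])
    fix q assume q: "q \<in> row_group col"
    \<comment> \<open>Antisymmetry of \<open>v\<close> trades the real sign for a composition with
      \<open>q\<close>; after reindexing, all \<open>q\<close> contribute the same inner
      product.\<close>
    have "v (f \<circ> q) = of_int (sign q) * v f" for f
      using colsym_comp[OF q, of w f] vw by simp
    then have "cnj (v f) * (of_int (sign q) * w (f \<circ> q)) = cnj (v (f \<circ> q)) * w (f \<circ> q)" for f
      by (cases q rule: sign_cases) simp_all
    then show "(\<Sum>f\<in>UNIV. cnj (v f) * (of_int (sign q) * w (f \<circ> q))) = (\<Sum>f\<in>UNIV. cnj (v f) * w f)"
      using sum_reindex_perm[of q "\<lambda>f. cnj (v f) * w f"] row_groupD[OF q] by (simp only:)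
  qed
  also have "(\<Sum>f\<in>UNIV. cnj (v f) * w f) = (\<Sum>p\<in>row_group row. \<Sum>f\<in>UNIV. cnj (v f) * T (f \<circ> p))"
    by (subst sum.swap) (simp add: w_def rowsym_def sum_distrib_left)
  also have "\<dots> = (\<Sum>p\<in>row_group row. \<Sum>f\<in>UNIV. cnj (v (f \<circ> inv p)) * T f)"
  proof (rule sum.cong[OF refl])
    fix p assume p: "p \<in> row_group row"
    show "(\<Sum>f\<in>UNIV. cnj (v f) * T (f \<circ> p)) = (\<Sum>f\<in>UNIV. cnj (v (f \<circ> inv p)) * T f)"
      using sum_reindex_perm[of p "\<lambda>f. cnj (v (f \<circ> inv p)) * T f"] row_groupD[OF p]
      by (simp add: comp_assoc row_group_inv_o[OF p])
  qed
  also have "\<dots> = (\<Sum>p\<in>row_group row. \<Sum>f\<in>UNIV. cnj (v (f \<circ> p)) * T f)"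
    by (rule sum_row_group_inv)
  also have "\<dots> = (\<Sum>f\<in>UNIV. cnj (rowsym row v f) * T f)"
    by (subst sum.swap) (simp add: rowsym_def sum_distrib_right)
  finally have "(\<Sum>f\<in>UNIV. cnj (v f) * v f) = 0"
    by (simp add: u0)
  moreover have "(\<Sum>f\<in>UNIV. cnj (v f) * v f) = of_real (\<Sum>f\<in>UNIV. (cmod (v f))\<^sup>2)"
    by (simp only: of_real_sum complex_norm_square mult.commute)
  ultimately have "(\<Sum>f\<in>UNIV. (cmod (v f))\<^sup>2) = 0"
    by (metis of_real_eq_0_iff)
  then have "v f = 0" for f
    by (subst (asm) sum_nonneg_eq_0_iff) auto
  then show False using v(2) by auto
qed

end

section \<open>Raising operators and Borel-stable lines\<close>

definition mmul :: "('n::finite \<Rightarrow> 'n \<Rightarrow> complex) \<Rightarrow> ('n \<Rightarrow> 'n \<Rightarrow> complex) \<Rightarrow> 'n \<Rightarrow> 'n \<Rightarrow> complex" where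
  "mmul g h = (\<lambda>i j. \<Sum>l\<in>UNIV. g i l * h l j)"

definition idm :: "'n \<Rightarrow> 'n \<Rightarrow> complex" where
  "idm = (\<lambda>i j. if i = j then 1 else 0)"

definition adj :: "('n \<Rightarrow> 'n \<Rightarrow> complex) \<Rightarrow> 'n \<Rightarrow> 'n \<Rightarrow> complex" where
  "adj U = (\<lambda>i j. cnj (U j i))"

definition upper :: "('n \<Rightarrow> nat) \<Rightarrow> ('n \<Rightarrow> 'n \<Rightarrow> complex) \<Rightarrow> bool" where
  "upper rk g \<longleftrightarrow> (\<forall>i j. rk j < rk i \<longrightarrow> g i j = 0)"

lemma mmul_assoc: "mmul (mmul g h) k = mmul g (mmul h k)"
  unfolding mmul_def sum_distrib_left sum_distrib_right
  by (intro ext, subst sum.swap) (simp add: mult.assoc)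

lemma mmul_idm [simp]: "mmul g idm = g" "mmul idm g = g"
  by (auto simp: mmul_def idm_def if_distrib if_distribR cong: if_cong)

lemma unitary_mat_iff: "unitary_mat U \<longleftrightarrow> mmul U (adj U) = idm \<and> mmul (adj U) U = idm"
  by (auto simp: unitary_mat_def mmul_def adj_def idm_def fun_eq_iff)

lemma invertible_mat_iff: "invertible_mat g \<longleftrightarrow> (\<exists>h. mmul g h = idm \<and> mmul h g = idm)"
  unfolding invertible_mat_def mmul_def idm_def fun_eq_iff by blast

lemma borel_elem_iff: "borel_elem U idx g \<longleftrightarrow> invertible_mat g \<and> upper idx (mmul (adj U) (mmul g U))"
  by (simp add: borel_elem_def upper_def mmul_def adj_def sum_distrib_left mult.assoc)

lemma prod_sum_UNIV:
  fixes F :: "'k::finite \<Rightarrow> 'n::finite \<Rightarrow> complex"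
  shows "(\<Prod>b\<in>UNIV. \<Sum>a\<in>UNIV. F b a) = (\<Sum>h\<in>UNIV. \<Prod>b\<in>UNIV. F b (h b))"
  using prod_sum_PiE[of UNIV "\<lambda>_. UNIV" F] by (simp add: PiE_UNIV_domain)

lemma tensor_power_act_mmul:
  "tensor_power_act g (tensor_power_act h T) = tensor_power_act (mmul g h) T"
proof
  fix f
  have "tensor_power_act g (tensor_power_act h T) f
      = (\<Sum>e\<in>UNIV. \<Sum>k\<in>UNIV. (\<Prod>b\<in>UNIV. g (f b) (k b) * h (k b) (e b)) * T e)"
    unfolding tensor_power_act_def sum_distrib_left
    by (subst sum.swap) (simp add: prod.distrib mult.assoc)
  also have "\<dots> = tensor_power_act (mmul g h) T f"
    by (simp add: tensor_power_act_def mmul_def prod_sum_UNIV sum_distrib_right)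
  finally show "tensor_power_act g (tensor_power_act h T) f = tensor_power_act (mmul g h) T f" .
qed

lemma prod_if_eq:
  fixes f h :: "'k::finite \<Rightarrow> 'n"
  shows "(\<Prod>b\<in>UNIV. if f b = h b then c b else 0) = (if h = f then \<Prod>b\<in>UNIV. c b else (0::complex))"
proof (cases "h = f")
  case False
  then obtain b where "f b \<noteq> h b" by (metis ext)
  then have "(\<Prod>b\<in>UNIV. if f b = h b then c b else 0) = 0"
    by (intro prod_zero) auto
  then show ?thesis using False by simp
qed simp

lemma tensor_power_act_diag:
  "tensor_power_act (\<lambda>i j. if i = j then d i else 0) T = (\<lambda>f. (\<Prod>b\<in>UNIV. d (f b)) * T f)"
  unfolding tensor_power_act_def prod_if_eq
  by (simp add: if_distrib[of "\<lambda>x. x * _"] cong: if_cong)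

lemma tensor_power_act_idm [simp]: "tensor_power_act idm T = T"
  using tensor_power_act_diag[of "\<lambda>_. 1" T] by (simp add: idm_def)

lemma tensor_power_act_row_tensor:
  "tensor_power_act g (row_tensor row x) = row_tensor row (\<lambda>i a. \<Sum>c\<in>UNIV. g a c * x i c)"
  by (simp add: tensor_power_act_def row_tensor_def prod_sum_UNIV prod.distrib)

text \<open>The diagonal action commutes with permuting the factors. Hence it commutes with both
  symmetrizers and preserves \<open>H_alpha\<close>.\<close>

lemma tensor_power_act_perm:
  assumes p: "p permutes UNIV"
  shows "tensor_power_act g T (f \<circ> p) = tensor_power_act g (\<lambda>h. T (h \<circ> p)) f"
proof -
  have "tensor_power_act g T (f \<circ> p) = (\<Sum>h\<in>UNIV. (\<Prod>b\<in>UNIV. g (f (p b)) (h (p b))) * T (h \<circ> p))"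
    unfolding tensor_power_act_def by (subst sum_reindex_perm[OF p, symmetric]) simp
  moreover have "(\<Prod>b\<in>UNIV. g (f (p b)) (h (p b))) = (\<Prod>b\<in>UNIV. g (f b) (h b))" for h
    using prod.permute[OF p, of "\<lambda>b. g (f b) (h b)"] by (simp add: comp_def)
  ultimately show ?thesis by (simp add: tensor_power_act_def)
qed

lemma tensor_power_act_scale: "tensor_power_act g (\<lambda>f. c * T f) = (\<lambda>f. c * tensor_power_act g T f)"
  by (simp add: tensor_power_act_def sum_distrib_left mult.left_commute)

lemma tensor_power_act_sum:
  "tensor_power_act g (\<lambda>f. \<Sum>x\<in>X. c x * S x f) = (\<lambda>f. \<Sum>x\<in>X. c x * tensor_power_act g (S x) f)"
  unfolding tensor_power_act_def sum_distrib_left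
  by (intro ext, subst sum.swap) (simp add: mult.left_commute)

lemma tensor_power_act_rowsym: "tensor_power_act g (rowsym row T) = rowsym row (tensor_power_act g T)"
proof -
  have "rowsym row (tensor_power_act g T) = (\<lambda>f. \<Sum>p\<in>row_group row. 1 * tensor_power_act g (\<lambda>h. T (h \<circ> p)) f)"
    unfolding rowsym_def by (intro ext sum.cong refl) (simp add: tensor_power_act_perm row_groupD)
  then show ?thesis
    using tensor_power_act_sum[of g "\<lambda>_. 1" "\<lambda>p h. T (h \<circ> p)" "row_group row"] by (simp add: rowsym_def)
qed

lemma tensor_power_act_colsym: "tensor_power_act g (colsym col T) = colsym col (tensor_power_act g T)"
proof -
  have "colsym col (tensor_power_act g T)
      = (\<lambda>f. \<Sum>q\<in>row_group col. of_int (sign q) * tensor_power_act g (\<lambda>h. T (h \<circ> q)) f)"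
    unfolding colsym_def by (intro ext sum.cong refl) (simp add: tensor_power_act_perm row_groupD)
  then show ?thesis
    using tensor_power_act_sum[of g "\<lambda>q. of_int (sign q)" "\<lambda>q h. T (h \<circ> q)" "row_group col"]
    by (simp add: colsym_def)
qed

lemma tensor_power_act_young_pi:
  "tensor_power_act g (young_pi row col T) = young_pi row col (tensor_power_act g T)"
  using tensor_power_act_scale[of g "inverse (of_int (young_mu row col))" "colsym col (rowsym row T)"]
  by (simp add: young_pi_eq tensor_power_act_colsym tensor_power_act_rowsym divide_inverse mult.commute)

lemma tensor_power_act_H_alpha: "T \<in> H_alpha row col \<Longrightarrow> tensor_power_act g T \<in> H_alpha row col"
  by (auto simp: H_alpha_def tensor_power_act_young_pi)

text \<open>The sum is the coefficient at \<open>f\<close> of the raising operator \<open>E\<^sub>m\<^sub>n\<close> acting as a derivation.\<close>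
definition raising_killed :: "('n \<Rightarrow> nat) \<Rightarrow> ('k::finite, 'n) tensor \<Rightarrow> bool" where
  "raising_killed rk v \<longleftrightarrow>
     (\<forall>m n f. rk m < rk n \<longrightarrow> (\<Sum>b | f b = m. v (f(b := n))) = 0)"

lemma raising_killed_add_scale:
  "raising_killed rk v \<Longrightarrow> raising_killed rk w \<Longrightarrow> raising_killed rk (\<lambda>f. v f + c * w f)"
  by (simp add: raising_killed_def sum.distrib flip: sum_distrib_left)

text \<open>A permutation only relabels boxes: changing \<open>f\<close> at \<open>b\<close> and
  then composing with \<open>p\<close> is changing \<open>f \<circ> p\<close> at
  \<open>inv p b\<close>.\<close>

lemma raising_killed_rowsym:
  assumes "raising_killed rk v"
  shows "raising_killed rk (rowsym row v)"
  unfolding raising_killed_def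
proof (intro allI impI)
  fix m n f assume mn: "rk m < rk n"
  have "(\<Sum>b | f b = m. rowsym row v (f(b := n))) = (\<Sum>p\<in>row_group row. \<Sum>b | f b = m. v (f(b := n) \<circ> p))"
    unfolding rowsym_def by (rule sum.swap)
  also have "\<dots> = (\<Sum>p\<in>row_group row. 0)"
  proof (rule sum.cong[OF refl])
    fix p assume "p \<in> row_group row"
    then have p: "p permutes UNIV" using row_groupD by blast
    have "(\<Sum>b | f b = m. v (f(b := n) \<circ> p)) = (\<Sum>b | (f \<circ> p) b = m. v ((f \<circ> p)(b := n)))"
    proof (rule sum.reindex_bij_witness[where i=p and j="inv p"])
      fix b assume "b \<in> {b. f b = m}"
      have "f(b := n) \<circ> p = (f \<circ> p)(inv p b := n)"
        using p by (auto simp: fun_eq_iff permutes_inverses) 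
      then show "v ((f \<circ> p)(inv p b := n)) = v (f(b := n) \<circ> p)" by simp
    qed (use p in \<open>auto simp: permutes_inverses\<close>)
    also have "\<dots> = 0" using assms mn by (simp only: raising_killed_def)
    finally show "(\<Sum>b | f b = m. v (f(b := n) \<circ> p)) = 0" .
  qed
  finally show "(\<Sum>b | f b = m. rowsym row v (f(b := n))) = 0" by simp
qed

text \<open>This is the stability condition of \<open>alpha_simple\<close> after the basis
  \<open>U\<close> has been moved to the standard one.\<close>

definition borel_line :: "('n \<Rightarrow> nat) \<Rightarrow> ('k::finite, 'n::finite) tensor \<Rightarrow> bool" where
  "borel_line rk v \<longleftrightarrow>
     (\<forall>g. invertible_mat g \<longrightarrow> upper rk g \<longrightarrow> (\<exists>c. tensor_power_act g v = (\<lambda>f. c * v f)))"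

text \<open>The diagonal matrix with 2 at \<open>m\<close> and 1 elsewhere multiplies the
  coefficient at \<open>f\<close> by 2 to the number of entries \<open>m\<close>. On a stable line
  this factor is the same on the whole support.\<close>

lemma borel_line_weight:
  fixes v :: "('k::finite, 'n::finite) tensor"
  assumes st: "borel_line rk v"
    and f: "v f \<noteq> 0" "v f' \<noteq> 0"
  shows "card {b. f b = m} = card {b. f' b = m}"
proof -
  define d :: "'n \<Rightarrow> complex" where "d i = (if i = m then 2 else 1)" for i
  let ?D = "\<lambda>d i j. if i = j then d i else (0::complex)"
  have mul: "mmul (?D d) (?D e) = ?D (\<lambda>i. d i * e i)" for d e :: "'n \<Rightarrow> complex"
  proof (intro ext)
    fix i j
    have "mmul (?D d) (?D e) i j = (\<Sum>l\<in>UNIV. if l = i then (if i = j then d i * e i else 0) else 0)"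
      unfolding mmul_def by (rule sum.cong[OF refl]) auto
    then show "mmul (?D d) (?D e) i j = (if i = j then d i * e i else 0)" by simp
  qed
  have "mmul (?D d) (?D (\<lambda>i. inverse (d i))) = idm" "mmul (?D (\<lambda>i. inverse (d i))) (?D d) = idm"
    unfolding mul by (auto simp: idm_def d_def fun_eq_iff)
  then have "invertible_mat (?D d)" by (auto simp: invertible_mat_iff)
  moreover have "upper rk (?D d)" by (auto simp: upper_def)
  ultimately obtain c where "tensor_power_act (?D d) v = (\<lambda>f. c * v f)" using st by (auto simp: borel_line_def)
  then have "(\<Prod>b\<in>UNIV. d (f b)) * v f = c * v f" for f
    unfolding tensor_power_act_diag by meson
  moreover have "(\<Prod>b\<in>UNIV. d (f b)) = 2 ^ card {b. f b = m}" for f :: "'k \<Rightarrow> 'n"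
    unfolding d_def by (subst prod.If_cases) auto
  ultimately have "c = 2 ^ card {b. f b = m}" "c = 2 ^ card {b. f' b = m}"
    using f by (metis mult_right_cancel)+
  then have "(2::complex) ^ card {b. f b = m} = 2 ^ card {b. f' b = m}" by simp
  then have "(2::nat) ^ card {b. f b = m} = 2 ^ card {b. f' b = m}"
    by (metis (mono_tags, lifting) of_nat_eq_iff of_nat_numeral of_nat_power)
  then show ?thesis by simp
qed

text \<open>The unipotent matrix \<open>g 1\<close>, the identity plus \<open>E_mn\<close>,
  preserves the line. At a coefficient where the raising sum is nonzero, weights force
  \<open>v f = 0\<close> and leave only the terms with a single change of \<open>m\<close> into
  \<open>n\<close>; their sum is the raising sum, which must therefore vanish.\<close>

lemma borel_line_raising_killed:
  fixes v :: "('k::finite, 'n::finite) tensor"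
  assumes st: "borel_line rk v"
  shows "raising_killed rk v"
  unfolding raising_killed_def
proof (intro allI impI, rule ccontr)
  fix m n f assume mn: "rk m < rk n" and nz: "(\<Sum>b | f b = m. v (f(b := n))) \<noteq> 0"
  have mn': "m \<noteq> n" using mn by auto
  obtain b0 where b0: "f b0 = m" "v (f(b0 := n)) \<noteq> 0"
    using sum.neutral[of "{b. f b = m}" "\<lambda>b. v (f(b := n))"] nz by blast
  \<comment> \<open>\<open>N\<close> is the number of entries \<open>m\<close> of every support
    element of \<open>v\<close>; the index \<open>f\<close> has one more and so lies outside the
    support.\<close>
  define N where "N = card {b. (f(b0 := n)) b = m}"
  have supp: "card {b. h b = m} = N" if "v h \<noteq> 0" for h
    unfolding N_def using that b0(2) by (rule borel_line_weight[OF st])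
  have cf: "card {b. f b = m} = Suc N"
  proof -
    have "{b. f b = m} = insert b0 {b. (f(b0 := n)) b = m}" using b0 mn' by auto
    then show ?thesis using mn' by (simp add: N_def)
  qed
  then have vf: "v f = 0" using supp[of f] by fastforce
  define g where "g t = (\<lambda>i j. if i = j then 1 else if i = m \<and> j = n then t else (0::complex))" for t
  have "mmul (g s) (g t) = g (s + t)" for s t
  proof (intro ext)
    fix i j
    have "mmul (g s) (g t) i j = (\<Sum>l\<in>UNIV. (if l = i then g t l j else 0) + (if l = n then (if i = m then s * g t n j else 0) else 0))"
      unfolding mmul_def by (rule sum.cong[OF refl]) (use mn' in \<open>auto simp: g_def\<close>)
    also have "\<dots> = g t i j + (if i = m then s * g t n j else 0)"
      by (simp add: sum.distrib)
    also have "\<dots> = g (s + t) i j" using mn' by (auto simp: g_def)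
    finally show "mmul (g s) (g t) i j = g (s + t) i j" .
  qed
  then have "mmul (g 1) (g (-1)) = g 0" "mmul (g (-1)) (g 1) = g 0" by simp_all
  moreover have "g 0 = idm" by (auto simp: g_def idm_def fun_eq_iff)
  ultimately have "invertible_mat (g 1)" by (auto simp: invertible_mat_iff)
  moreover have "upper rk (g 1)" using mn by (auto simp: upper_def g_def)
  ultimately obtain c where "tensor_power_act (g 1) v = (\<lambda>f. c * v f)" using st by (auto simp: borel_line_def)
  then have zero: "tensor_power_act (g 1) v f = 0" using vf by simp
  \<comment> \<open>These are the \<open>h\<close> obtained from \<open>f\<close> by changing some
    entries \<open>m\<close> into \<open>n\<close>; for them the matrix entry of the tensor power is
    1, for all others 0.\<close>
  let ?ok = "\<lambda>h. \<forall>b. h b = f b \<or> (f b = m \<and> h b = n)"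
  have "tensor_power_act (g 1) v f = (\<Sum>h\<in>UNIV. if ?ok h then v h else 0)"
    unfolding tensor_power_act_def
  proof (rule sum.cong[OF refl])
    fix h
    show "(\<Prod>b\<in>UNIV. g 1 (f b) (h b)) * v h = (if ?ok h then v h else 0)"
    proof (cases "?ok h")
      case True
      then have "g 1 (f b) (h b) = 1" for b by (cases "h b = f b") (auto simp: g_def)
      then show ?thesis using True by simp
    next
      case False
      then obtain b where "h b \<noteq> f b" "\<not> (f b = m \<and> h b = n)" by blast
      then have "g 1 (f b) (h b) = 0" by (auto simp: g_def)
      then have "(\<Prod>b\<in>UNIV. g 1 (f b) (h b)) = 0" by (intro prod_zero) auto
      then show ?thesis unfolding if_not_P[OF False] by simp
    qed
  qed
  also have "\<dots> = (\<Sum>h\<in>(\<lambda>b. f(b := n)) ` {b. f b = m}. if ?ok h then v h else 0)"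
  proof (rule sum.mono_neutral_right)
    show "\<forall>h\<in>UNIV - (\<lambda>b. f(b := n)) ` {b. f b = m}. (if ?ok h then v h else 0) = 0"
    proof (intro ballI, rule ccontr)
      fix h assume h: "h \<in> UNIV - (\<lambda>b. f(b := n)) ` {b. f b = m}"
        and "(if ?ok h then v h else 0) \<noteq> 0"
      then have ok: "?ok h" and vh: "v h \<noteq> 0" by (auto split: if_splits)
      \<comment> \<open>Comparing the counts \<open>N\<close> and \<open>Suc N\<close> shows that a
        contributing \<open>h\<close> differs from \<open>f\<close> in exactly one box.\<close>
      have "{b. h b = m} = {b. f b = m} - {b. h b \<noteq> f b}"
      proof (intro equalityI subsetI)
        fix b assume "b \<in> {b. h b = m}"
        then show "b \<in> {b. f b = m} - {b. h b \<noteq> f b}" using ok[rule_format, of b] mn' by auto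
      qed auto
      moreover have sub: "{b. h b \<noteq> f b} \<subseteq> {b. f b = m}" using ok by auto
      ultimately have "N = Suc N - card {b. h b \<noteq> f b}"
        using supp[OF vh] cf by (simp add: card_Diff_subset)
      moreover have "card {b. h b \<noteq> f b} \<le> Suc N"
        using sub cf by (metis card_mono finite_code)
      ultimately have "card {b. h b \<noteq> f b} = 1" by linarith
      then obtain b where b: "{b. h b \<noteq> f b} = {b}" by (auto simp: card_1_singleton_iff)
      then have fb: "f b = m" "h b = n" using ok by auto
      have "h = f(b := n)"
      proof
        fix b' show "h b' = (f(b := n)) b'" using b fb by (cases "b' = b") auto
      qed
      then show False using h fb by blast
    qed
  qed auto
  also have "\<dots> = (\<Sum>b | f b = m. v (f(b := n)))"
  proof (subst sum.reindex)
    show "inj_on (\<lambda>b. f(b := n)) {b. f b = m}"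
      using mn' by (auto simp: inj_on_def fun_eq_iff)
  qed (auto intro!: sum.cong)
  finally show False using zero nz by simp
qed

section \<open>Support of tensors killed by the raising operators\<close>

context tableau
begin

text \<open>Row by row, a support element minimizing the sum of the ranks in row \<open>i\<close> among those with
  the bound in all earlier rows satisfies it in row \<open>i\<close> too: an entry \<open>n\<close> of rank \<open>> i\<close> there could be
  raised to the basis vector of rank \<open>i\<close>, which does not occur in the earlier rows.\<close>
lemma raising_killed_support:
  fixes u :: "('k, 'n::finite) tensor"
  assumes rk: "bij_betw rk UNIV {..<card (UNIV :: 'n set)}"
    and sym: "\<And>p f. p \<in> row_group row \<Longrightarrow> u (f \<circ> p) = u f"
    and kill: "raising_killed rk u" and nz: "u \<noteq> (\<lambda>_. 0)"
  shows "\<exists>f. u f \<noteq> 0 \<and> (\<forall>b. rk (f b) \<le> row b)"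
proof -
  have "\<exists>f. u f \<noteq> 0 \<and> (\<forall>b. row b < i \<longrightarrow> rk (f b) \<le> row b)" for i
  proof (induction i)
    case 0
    then show ?case using nz by auto
  next
    case (Suc i)
    let ?P = "\<lambda>f. u f \<noteq> 0 \<and> (\<forall>b. row b < i \<longrightarrow> rk (f b) \<le> row b)"
    let ?s = "\<lambda>f. \<Sum>b | row b = i. rk (f b)"
    obtain f0 where f0: "?P f0" using Suc by blast
    obtain f where "?P f \<and> (\<forall>h. ?P h \<longrightarrow> ?s f \<le> ?s h)"
      using ex_has_least_nat[of ?P f0 ?s, OF f0] by (rule exE)
    then have f: "?P f" and min: "\<And>h. ?P h \<Longrightarrow> ?s f \<le> ?s h" by simp_all
    have "rk (f b0) \<le> i" if b0: "row b0 = i" for b0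
    proof (rule ccontr)
      assume gt: "\<not> rk (f b0) \<le> i"
      define n where "n = f b0"
      have "rk n < card (UNIV :: 'n set)" using rk by (auto simp: bij_betw_def)
      then have "i \<in> rk ` UNIV" using rk gt by (auto simp: bij_betw_def n_def)
      then obtain m where m: "rk m = i" by auto
      have mn: "rk m < rk n" using gt m n_def by simp
      \<comment> \<open>Lowering \<open>b0\<close> to \<open>m\<close> makes \<open>f\<close> itself
        a term of the raising sum at \<open>f'\<close>.\<close>
      define f' where "f' = f(b0 := m)"
      have "(\<Sum>b | f' b = m. u (f'(b := n))) = (\<Sum>b | f' b = m. if row b = i then u f else 0)"
      proof (rule sum.cong[OF refl])
        fix b assume "b \<in> {b. f' b = m}"
        then have b: "f' b = m" by simp
        \<comment> \<open>Earlier rows cannot contain \<open>m\<close>, whose rank is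
          \<open>i\<close>. In row \<open>i\<close> the result is \<open>f\<close> with two boxes of
          that row exchanged. In later rows the rank sum of row \<open>i\<close> has dropped, so
          minimality makes \<open>u\<close> vanish. Thus the sum is a positive multiple of
          \<open>u f\<close>, as \<open>b0\<close> itself is counted.\<close>
        consider "row b < i" | "row b = i" | "row b > i" by linarith
        then show "u (f'(b := n)) = (if row b = i then u f else 0)"
        proof cases
          case 1
          then have "rk (f b) \<le> row b" "f b = m" using f b b0 by (auto simp: f'_def split: if_splits)
          then show ?thesis using 1 m by simp
        next
          case 2
          have "f'(b := n) = f \<circ> transpose b b0"
            using b by (auto simp: f'_def fun_eq_iff n_def transpose_def)
          then show ?thesis using sym[of "transpose b b0" f] 2 b0 by (simp add: transpose_in_row_group)
        next
          case 3
          let ?h = "f'(b := n)"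
          have "?s ?h < ?s f"
          proof (rule sum_strict_mono_ex1)
            show "\<forall>b'\<in>{b. row b = i}. rk (?h b') \<le> rk (f b')"
              using 3 mn by (auto simp: f'_def n_def)
            show "\<exists>b'\<in>{b. row b = i}. rk (?h b') < rk (f b')"
              using 3 mn b0 by (intro bexI[of _ b0]) (auto simp: f'_def n_def)
          qed simp
          moreover have "\<forall>b'. row b' < i \<longrightarrow> rk (?h b') \<le> row b'"
            using f 3 b0 by (auto simp: f'_def)
          ultimately have "u ?h = 0" using min[of ?h] by force
          then show ?thesis using 3 by simp
        qed
      qed
      also have "\<dots> = of_nat (card {b. f' b = m \<and> row b = i}) * u f"
        by (simp add: sum.If_cases Int_def)
      finally have "of_nat (card {b. f' b = m \<and> row b = i}) * u f = 0"
        using kill mn by (simp add: raising_killed_def)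
      then have "card {b. f' b = m \<and> row b = i} = 0" using f by simp
      then show False using b0 by (auto simp: f'_def)
    qed
    then show ?case using f by (intro exI[of _ f]) (auto simp: less_Suc_eq)
  qed
  from this[of r] show ?thesis using row_less by blast
qed

text \<open>Passing to \<open>rowsym row v\<close> supplies the row symmetry that \<open>v\<close>
  may lack. A row permutation brings the support element back to \<open>v\<close> without disturbing
  the rank bound, and antisymmetry makes ranks distinct within columns.\<close>

lemma raising_killed_H_alpha:
  fixes v :: "('k, 'n::finite) tensor"
  assumes rk: "bij_betw rk UNIV {..<card (UNIV :: 'n set)}"
    and v: "v \<in> H_alpha row col" "v \<noteq> (\<lambda>_. 0)" and kill: "raising_killed rk v"
  shows "\<exists>g. v g \<noteq> 0 \<and> (\<forall>b. rk (g b) = row b)"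
proof -
  have "\<exists>f. rowsym row v f \<noteq> 0 \<and> (\<forall>b. rk (f b) \<le> row b)"
    using rk rowsym_comp raising_killed_rowsym[OF kill] rowsym_nonzero[OF v]
    by (rule raising_killed_support)
  then obtain f where f: "rowsym row v f \<noteq> 0" "\<And>b. rk (f b) \<le> row b" by blast
  then obtain p where p: "p \<in> row_group row" "v (f \<circ> p) \<noteq> 0"
    using sum.neutral[of "row_group row" "\<lambda>p. v (f \<circ> p)"] unfolding rowsym_def by blast
  have le: "rk ((f \<circ> p) b) \<le> row b" for b
    using f(2)[of "p b"] row_groupD[OF p(1), of b] by simp
  obtain T where T: "v = young_pi row col T" using v(1) by (auto simp: H_alpha_def)
  have "rk ((f \<circ> p) b) \<noteq> rk ((f \<circ> p) b')" if "b \<noteq> b'" "col b = col b'" for b b'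
  proof
    assume "rk ((f \<circ> p) b) = rk ((f \<circ> p) b')"
    then have "(f \<circ> p) b = (f \<circ> p) b'" using rk by (meson UNIV_I bij_betw_imp_inj_on inj_onD)
    then have "v (f \<circ> p) = 0"
      using colsym_repeated_index[of b b' col "f \<circ> p", OF that] by (simp add: T young_pi_eq)
    then show False using p by simp
  qed
  then have "rk ((f \<circ> p) b) = row b" for b using column_filling_unique[of "\<lambda>b. rk ((f \<circ> p) b)", OF le] by blast
  then show ?thesis using p by blast
qed

end

section \<open>Gram-Schmidt for flags\<close>

definition orthonormal :: "nat \<Rightarrow> (nat \<Rightarrow> 'n::finite \<Rightarrow> complex) \<Rightarrow> bool" where
  "orthonormal m u \<longleftrightarrow> (\<forall>i<m. \<forall>j<m. (\<Sum>a\<in>UNIV. cnj (u i a) * u j a) = (if i = j then 1 else 0))"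

definition residual :: "nat \<Rightarrow> (nat \<Rightarrow> 'n::finite \<Rightarrow> complex) \<Rightarrow> ('n \<Rightarrow> complex) \<Rightarrow> 'n \<Rightarrow> complex" where
  "residual m u y = (\<lambda>a. y a - (\<Sum>i<m. (\<Sum>c\<in>UNIV. cnj (u i c) * y c) * u i a))"

definition lin_span :: "nat \<Rightarrow> (nat \<Rightarrow> 'n \<Rightarrow> complex) \<Rightarrow> ('n \<Rightarrow> complex) \<Rightarrow> bool" where
  "lin_span m x y \<longleftrightarrow> (\<exists>c. \<forall>a. y a = (\<Sum>i<m. c i * x i a))"

lemma lin_span_Suc: "lin_span m x y \<Longrightarrow> lin_span (Suc m) x y"
proof -
  assume "lin_span m x y"
  then obtain c where "\<And>a. y a = (\<Sum>i<m. c i * x i a)" by (auto simp: lin_span_def)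
  then have "\<forall>a. y a = (\<Sum>i<Suc m. (c(m := 0)) i * x i a)" by simp
  then show ?thesis unfolding lin_span_def by blast
qed

lemma lin_span_last: "lin_span (Suc m) x (x m)"
proof -
  have "\<forall>a. x m a = (\<Sum>i<Suc m. (if i = m then 1 else 0) * x i a)" by simp
  then show ?thesis unfolding lin_span_def by (rule exI[of _ "\<lambda>i. if i = m then 1 else 0"])
qed

lemma lin_span_comb:
  assumes "\<And>i. i < k \<Longrightarrow> lin_span m x (u i)"
  shows "lin_span m x (\<lambda>a. \<Sum>i<k. w i * u i a)"
proof -
  have "\<forall>i. \<exists>c. i < k \<longrightarrow> (\<forall>a. u i a = (\<Sum>j<m. c j * x j a))"
    using assms by (auto simp: lin_span_def)
  then obtain C where C: "\<And>i a. i < k \<Longrightarrow> u i a = (\<Sum>j<m. C i j * x j a)"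
    by metis
  have "(\<Sum>i<k. w i * u i a) = (\<Sum>j<m. (\<Sum>i<k. w i * C i j) * x j a)" for a
    unfolding sum_distrib_right
    by (subst sum.swap) (simp add: C sum_distrib_left mult.assoc)
  then show ?thesis unfolding lin_span_def by (intro exI allI)
qed

lemma lin_span_diff_scale:
  assumes "lin_span m x y" "lin_span m x z"
  shows "lin_span m x (\<lambda>a. (y a - z a) / N)"
proof -
  obtain c d where "\<And>a. y a = (\<Sum>i<m. c i * x i a)" "\<And>a. z a = (\<Sum>i<m. d i * x i a)"
    using assms by (auto simp: lin_span_def)
  then have "(y a - z a) / N = (\<Sum>i<m. ((c i - d i) / N) * x i a)" for a
    by (simp add: sum_subtractf sum_divide_distrib diff_divide_distrib left_diff_distrib)
  then show ?thesis unfolding lin_span_def by (intro exI allI)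
qed

lemma wedge_nonzero_not_lin_span:
  assumes "wedge_nonzero r x" "m < r"
  shows "\<not> lin_span m x (x m)"
proof
  assume "lin_span m x (x m)"
  then obtain c where c: "\<And>a. x m a = (\<Sum>i<m. c i * x i a)" by (auto simp: lin_span_def)
  define e where "e i = (if i < m then c i else if i = m then - 1 else 0)" for i
  have "(\<Sum>i<r. e i * x i a) = 0" for a
  proof -
    have "(\<Sum>i<r. e i * x i a) = (\<Sum>i<Suc m. e i * x i a)"
      by (rule sum.mono_neutral_right) (use assms(2) in \<open>auto simp: e_def\<close>)
    then show ?thesis by (simp add: e_def c)
  qed
  then have "e m = 0" using assms unfolding wedge_nonzero_def by blast
  then show False by (simp add: e_def)
qed

lemma residual_orthogonal:
  assumes "orthonormal m u" "i < m"
  shows "(\<Sum>a\<in>UNIV. cnj (u i a) * residual m u y a) = 0"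
proof -
  let ?k = "\<lambda>j. \<Sum>c\<in>UNIV. cnj (u j c) * y c"
  have "(\<Sum>a\<in>UNIV. cnj (u i a) * (\<Sum>j<m. ?k j * u j a)) = (\<Sum>j<m. ?k j * (\<Sum>a\<in>UNIV. cnj (u i a) * u j a))"
    unfolding sum_distrib_left[of "cnj _"] sum_distrib_left[of "sum _ UNIV"]
    by (subst sum.swap) (simp add: mult.left_commute)
  also have "\<dots> = (\<Sum>j<m. if j = i then ?k i else 0)"
    by (rule sum.cong[OF refl]) (use assms in \<open>auto simp: orthonormal_def\<close>)
  also have "\<dots> = ?k i" using assms(2) by simp
  finally show ?thesis by (simp add: residual_def right_diff_distrib sum_subtractf)
qed

lemma sum_cnj_self: "(\<Sum>a\<in>A. cnj (v a) * v a) = of_real (\<Sum>a\<in>A. (cmod (v a))\<^sup>2)"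
  by (simp add: complex_norm_square mult.commute del: of_real_power)

lemma sum_cmod_pos:
  fixes v :: "'a::finite \<Rightarrow> complex"
  assumes "v \<noteq> (\<lambda>_. 0)"
  shows "(\<Sum>a\<in>UNIV. (cmod (v a))\<^sup>2) > 0"
proof -
  obtain a where "v a \<noteq> 0" using assms by auto
  then show ?thesis by (intro sum_pos2[of _ a]) auto
qed

text \<open>The normalizing factor \<open>N\<close> is kept visible because it becomes a diagonal
  entry of the triangular matrix.\<close>

lemma gram_schmidt_step:
  assumes u: "orthonormal m u" and nz: "residual m u y \<noteq> (\<lambda>_. 0)"
  shows "\<exists>N. N \<noteq> 0 \<and> orthonormal (Suc m) (u(m := (\<lambda>a. residual m u y a / N)))"
proof -
  let ?R = "residual m u y"
  define S where "S = (\<Sum>a\<in>UNIV. (cmod (?R a))\<^sup>2)"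
  have S: "S > 0" unfolding S_def using nz by (rule sum_cmod_pos)
  define N where "N = complex_of_real (sqrt S)"
  have N: "N \<noteq> 0" "N * N = of_real S" "cnj N = N"
    using S by (auto simp: N_def simp flip: of_real_mult)
  let ?z = "\<lambda>a. ?R a / N"
  have zz: "(\<Sum>a\<in>UNIV. cnj (?z a) * ?z a) = 1"
  proof -
    have "(\<Sum>a\<in>UNIV. cnj (?z a) * ?z a) = (\<Sum>a\<in>UNIV. cnj (?R a) * ?R a) / (N * N)"
      by (simp add: N(3) sum_divide_distrib)
    also have "\<dots> = of_real S / of_real S" by (simp only: sum_cnj_self N(2) S_def)
    finally show ?thesis using S by simp
  qed
  have uz: "(\<Sum>a\<in>UNIV. cnj (u i a) * ?z a) = 0" if "i < m" for i
    using residual_orthogonal[OF u that, of y] by (simp flip: sum_divide_distrib)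
  have zu: "(\<Sum>a\<in>UNIV. cnj (?z a) * u i a) = 0" if "i < m" for i
    using arg_cong[OF uz[OF that], of cnj] by (simp add: mult.commute)
  have "orthonormal (Suc m) (u(m := ?z))"
    unfolding orthonormal_def
  proof (intro allI impI)
    fix i j assume "i < Suc m" "j < Suc m"
    then consider "i < m" "j < m" | "i < m" "j = m" | "i = m" "j < m" | "i = m" "j = m" by linarith
    then show "(\<Sum>a\<in>UNIV. cnj ((u(m := ?z)) i a) * (u(m := ?z)) j a) = (if i = j then 1 else 0)"
    proof cases
      case 1 then show ?thesis using u by (auto simp: orthonormal_def)
    next
      case 2 then show ?thesis using uz by auto
    next
      case 3 then show ?thesis using zu by auto
    next
      case 4 then show ?thesis using zz by simp
    qed
  qed
  then show ?thesis using N(1) by blast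
qed

text \<open>The kernel \<open>R\<close> is the orthogonal projector onto the complement of the span of the \<open>u i\<close>, so its squared
  Hilbert-Schmidt norm is its trace, i.e. the codimension of the span.\<close>
lemma orthonormal_defect:
  fixes u :: "nat \<Rightarrow> 'n::finite \<Rightarrow> complex"
  assumes u: "orthonormal m u"
  defines "R \<equiv> (\<lambda>a c. (if a = c then 1 else 0) - (\<Sum>i<m. cnj (u i a) * u i c))"
  shows "(\<Sum>a\<in>UNIV. \<Sum>c\<in>UNIV. (cmod (R a c))\<^sup>2) = real (card (UNIV :: 'n set)) - real m"
proof -
  define K where "K a c = (\<Sum>i<m. cnj (u i a) * u i c)" for a c
  have R: "R a c = (if a = c then 1 else 0) - K a c" for a c by (simp add: R_def K_def)
  have cR: "cnj (R a c) = R c a" for a c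
    by (simp add: R K_def mult.commute)
  have KK: "(\<Sum>c\<in>UNIV. K a c * K c b) = K a b" for a b
  proof -
    have "(\<Sum>c\<in>UNIV. K a c * K c b)
        = (\<Sum>c\<in>UNIV. \<Sum>i<m. \<Sum>j<m. cnj (u i a) * u j b * (cnj (u j c) * u i c))"
      unfolding K_def sum_product by (simp add: ac_simps)
    also have "\<dots> = (\<Sum>i<m. \<Sum>j<m. cnj (u i a) * u j b * (\<Sum>c\<in>UNIV. cnj (u j c) * u i c))"
      unfolding sum_distrib_left
      by (rule trans[OF sum.swap], rule sum.cong[OF refl], rule sum.swap)
    also have "\<dots> = (\<Sum>i<m. \<Sum>j<m. if j = i then cnj (u i a) * u i b else 0)"
      by (intro sum.cong refl) (use u in \<open>auto simp: orthonormal_def\<close>)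
    also have "\<dots> = K a b" by (simp add: K_def)
    finally show ?thesis .
  qed
  have RR: "(\<Sum>c\<in>UNIV. R a c * R c a) = R a a" for a
  proof -
    have "R a c * R c a = (if c = a then 1 - 2 * K a a else 0) + K a c * K c a" for c
      by (auto simp: R algebra_simps)
    then show ?thesis by (simp add: sum.distrib KK R)
  qed
  have "complex_of_real (\<Sum>a\<in>UNIV. \<Sum>c\<in>UNIV. (cmod (R a c))\<^sup>2) = (\<Sum>a\<in>UNIV. \<Sum>c\<in>UNIV. R a c * R c a)"
    by (simp add: complex_norm_square cR del: of_real_power)
  also have "\<dots> = of_nat (card (UNIV :: 'n set)) - (\<Sum>a\<in>UNIV. K a a)"
    unfolding RR by (simp add: R sum_subtractf)
  also have "(\<Sum>a\<in>UNIV. K a a) = (\<Sum>i<m. \<Sum>a\<in>UNIV. cnj (u i a) * u i a)"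
    unfolding K_def by (rule sum.swap)
  also have "\<dots> = of_nat m" using u by (simp add: orthonormal_def)
  finally have "complex_of_real (\<Sum>a\<in>UNIV. \<Sum>c\<in>UNIV. (cmod (R a c))\<^sup>2)
      = complex_of_real (real (card (UNIV :: 'n set)) - real m)" by simp
  then show ?thesis by (simp only: of_real_eq_iff)
qed

text \<open>The rows of the kernel in \<open>orthonormal_defect\<close> are residuals of unit
  vectors, so below full dimension some unit vector has nonzero residual.\<close>

lemma residual_unit_vector:
  "residual m u (\<lambda>c. if c = a then 1 else 0) = (\<lambda>c. (if a = c then 1 else 0) - (\<Sum>i<m. cnj (u i a) * u i c))"
proof -
  have "(\<Sum>c\<in>UNIV. cnj (u i c) * (if c = a then 1 else 0)) = cnj (u i a)" for i
    by (simp add: if_distrib[of "\<lambda>z. _ * z"] cong: if_cong)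
  then show ?thesis by (auto simp: residual_def fun_eq_iff)
qed

text \<open>The vectors \<open>x i\<close> are processed first, then unit vectors complete the
  basis. The bound is a maximum because \<open>r\<close> is not yet known to be at most the
  dimension. The span clause keeps \<open>x m\<close> independent of the earlier
  \<open>u i\<close>.\<close>

lemma gram_schmidt_triangular:
  fixes x :: "nat \<Rightarrow> 'n::finite \<Rightarrow> complex"
  assumes x: "wedge_nonzero r x"
  shows "m \<le> max r (card (UNIV :: 'n set)) \<Longrightarrow>
    \<exists>u A. orthonormal m u \<and>
      (\<forall>i. i < m \<longrightarrow> i < r \<longrightarrow> A i i \<noteq> 0 \<and> (\<forall>a. x i a = (\<Sum>j\<le>i. A i j * u j a))) \<and>
      (m \<le> r \<longrightarrow> (\<forall>i<m. lin_span m x (u i)))"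
proof (induction m)
  case 0
  then show ?case by (auto simp: orthonormal_def)
next
  case (Suc m)
  then obtain u A where u: "orthonormal m u"
    and A: "\<And>i. i < m \<Longrightarrow> i < r \<Longrightarrow> A i i \<noteq> 0 \<and> (\<forall>a. x i a = (\<Sum>j\<le>i. A i j * u j a))"
    and span: "\<And>i. m \<le> r \<Longrightarrow> i < m \<Longrightarrow> lin_span m x (u i)"
    by (metis Suc_leD)
  define k where "k i = (\<Sum>c\<in>UNIV. cnj (u i c) * x m c)" for i
  have resx: "residual m u (x m) = (\<lambda>a. x m a - (\<Sum>i<m. k i * u i a))"
    by (simp add: residual_def k_def)
  have "\<exists>y. residual m u y \<noteq> (\<lambda>_. 0) \<and> (m < r \<longrightarrow> y = x m)"
  proof (cases "m < r")
    case True
    have "residual m u (x m) \<noteq> (\<lambda>_. 0)"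
    proof
      assume "residual m u (x m) = (\<lambda>_. 0)"
      then have "x m = (\<lambda>a. \<Sum>i<m. k i * u i a)" by (auto simp: resx fun_eq_iff)
      moreover have "lin_span m x (\<lambda>a. \<Sum>i<m. k i * u i a)"
        using span True by (intro lin_span_comb) auto
      ultimately show False using wedge_nonzero_not_lin_span[OF x True] by simp
    qed
    then show ?thesis by blast
  next
    case False
    then have "m < card (UNIV :: 'n set)" using Suc.prems by auto
    then have ne: "(\<Sum>a\<in>UNIV. \<Sum>c\<in>UNIV. (cmod ((if a = c then 1 else 0) - (\<Sum>i<m. cnj (u i a) * u i c)))\<^sup>2) \<noteq> 0"
      unfolding orthonormal_defect[OF u] by simp
    have "\<exists>a. residual m u (\<lambda>c. if c = a then 1 else 0) \<noteq> (\<lambda>_. 0)"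
    proof (rule ccontr)
      assume "\<not> ?thesis"
      then have "(if a = c then 1 else 0) - (\<Sum>i<m. cnj (u i a) * u i c) = 0" for a c
        unfolding residual_unit_vector by meson
      then show False using ne by simp
    qed
    then show ?thesis using False by blast
  qed
  then obtain y where y: "residual m u y \<noteq> (\<lambda>_. 0)" "m < r \<Longrightarrow> y = x m" by blast
  obtain N where N: "N \<noteq> 0" "orthonormal (Suc m) (u(m := (\<lambda>a. residual m u y a / N)))"
    using gram_schmidt_step[OF u y(1)] by blast
  define u' where "u' = u(m := (\<lambda>a. residual m u y a / N))"
  \<comment> \<open>The new row consists of the Fourier coefficients of \<open>x m\<close>, with
    \<open>N\<close> on the diagonal.\<close>
  define A' where "A' = A(m := k(m := N))"
  have "A' i i \<noteq> 0 \<and> (\<forall>a. x i a = (\<Sum>j\<le>i. A' i j * u' j a))" if "i < Suc m" "i < r" for i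
  proof (cases "i = m")
    case False
    then have "i < m" using that by simp
    then have "(\<Sum>j\<le>i. A' i j * u' j a) = (\<Sum>j\<le>i. A i j * u j a)" for a
      by (intro sum.cong) (auto simp: A'_def u'_def)
    moreover have "A' i i = A i i" using False by (simp add: A'_def)
    ultimately show ?thesis using A[OF \<open>i < m\<close> that(2)] by simp
  next
    case True
    then have "m < r" using that by simp
    have "(\<Sum>j\<le>m. A' m j * u' j a) = (\<Sum>j<m. k j * u j a) + residual m u (x m) a" for a
    proof -
      have "(\<Sum>j\<le>m. A' m j * u' j a) = (\<Sum>j<m. A' m j * u' j a) + A' m m * u' m a"
        by (simp flip: lessThan_Suc_atMost)
      moreover have "(\<Sum>j<m. A' m j * u' j a) = (\<Sum>j<m. k j * u j a)"
        by (intro sum.cong) (auto simp: A'_def u'_def)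
      ultimately show ?thesis using N(1) y(2)[OF \<open>m < r\<close>] by (simp add: A'_def u'_def)
    qed
    then show ?thesis using True N(1) by (simp add: resx) (simp add: A'_def)
  qed
  moreover have "lin_span (Suc m) x (u' i)" if "Suc m \<le> r" "i < Suc m" for i
  proof (cases "i = m")
    case False
    then show ?thesis using that span[of i] by (auto simp: u'_def intro: lin_span_Suc)
  next
    case True
    have "lin_span m x (\<lambda>a. \<Sum>i<m. k i * u i a)"
      using span that by (intro lin_span_comb) auto
    then have "lin_span (Suc m) x (\<lambda>a. (x m a - (\<Sum>i<m. k i * u i a)) / N)"
      by (intro lin_span_diff_scale lin_span_last lin_span_Suc)
    then show ?thesis using True that y(2) resx by (simp add: u'_def)
  qed
  ultimately show ?case using N(2) unfolding u'_def[symmetric] by (intro exI[of _ u'] exI[of _ A']) blast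
qed

lemma unitary_flag:
  fixes x :: "nat \<Rightarrow> 'n::finite \<Rightarrow> complex"
  assumes x: "wedge_nonzero r x" and rk: "bij_betw rk UNIV {..<card (UNIV :: 'n set)}"
  shows "r \<le> card (UNIV :: 'n set) \<and>
    (\<exists>u A. unitary_mat (\<lambda>a n. u (rk n) a) \<and>
      (\<forall>i<r. A i i \<noteq> 0 \<and> (\<forall>a. x i a = (\<Sum>j\<le>i. A i j * u j a))))"
proof -
  let ?d = "card (UNIV :: 'n set)"
  obtain u A where u: "orthonormal (max r ?d) u"
    and A: "\<And>i. i < max r ?d \<Longrightarrow> i < r \<Longrightarrow> A i i \<noteq> 0 \<and> (\<forall>a. x i a = (\<Sum>j\<le>i. A i j * u j a))"
    using gram_schmidt_triangular[OF x order.refl] by blast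
  \<comment> \<open>The defect is a sum of squares, so there are at most \<open>?d\<close>
    orthonormal vectors. At exactly \<open>?d\<close> it vanishes, which is the completeness
    relation needed for unitarity.\<close>
  have "0 \<le> real ?d - real (max r ?d)"
    unfolding orthonormal_defect[OF u, symmetric] by (intro sum_nonneg) simp
  then have r: "r \<le> ?d" by simp
  then have ud: "orthonormal ?d u" using u by (simp add: max_absorb2)
  define R where "R a c = (if a = c then 1 else 0) - (\<Sum>i<?d. cnj (u i a) * u i c)" for a c
  have "(\<Sum>a\<in>UNIV. \<Sum>c\<in>UNIV. (cmod (R a c))\<^sup>2) = 0"
    unfolding R_def orthonormal_defect[OF ud] by simp
  then have R0: "R a c = 0" for a c
    by (simp add: sum_nonneg_eq_0_iff sum_nonneg)
  have "(\<Sum>l\<in>UNIV. u (rk l) a * cnj (u (rk l) c)) = (if a = c then 1 else 0)" for a c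
  proof -
    have "(\<Sum>l\<in>UNIV. u (rk l) a * cnj (u (rk l) c)) = (\<Sum>i<?d. u i a * cnj (u i c))"
      by (rule sum.reindex_bij_betw[OF rk])
    then show ?thesis using R0[of c a] by (auto simp: R_def mult.commute)
  qed
  moreover have "(\<Sum>l\<in>UNIV. cnj (u (rk i) l) * u (rk j) l) = (if i = j then 1 else 0)" for i j
  proof -
    have "rk i < ?d" "rk j < ?d" "rk i = rk j \<longleftrightarrow> i = j"
      using rk by (auto simp: bij_betw_def inj_on_def)
    then show ?thesis using ud by (simp add: orthonormal_def)
  qed
  ultimately have "unitary_mat (\<lambda>a n. u (rk n) a)" by (simp add: unitary_mat_def)
  then show ?thesis using r A by (auto intro!: exI[of _ u] exI[of _ A])
qed

section \<open>Highest-weight vectors and the Segre map\<close>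

text \<open>The standard basis vector of rank \<open>i\<close>, or zero if no index has that
  rank.\<close>

definition rank_basis :: "('n \<Rightarrow> nat) \<Rightarrow> nat \<Rightarrow> 'n \<Rightarrow> complex" where
  "rank_basis rk i = (\<lambda>n. if rk n = i then 1 else 0)"

text \<open>Replacing \<open>idx\<close> by the ranks \<open>0\<close>, \<open>1\<close>, ... keeps
  the Borel subgroup and allows ranks to be compared with row numbers.\<close>

lemma inj_rank:
  fixes idx :: "'n::finite \<Rightarrow> nat"
  assumes "inj idx"
  shows "\<exists>rk. bij_betw rk UNIV {..<card (UNIV :: 'n set)} \<and> (\<forall>m n. rk m < rk n \<longleftrightarrow> idx m < idx n)"
proof -
  define rk where "rk n = card {m. idx m < idx n}" for n
  have mono: "rk m < rk n" if "idx m < idx n" for m n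
    unfolding rk_def by (rule psubset_card_mono) (use that in auto)
  have iff: "rk m < rk n \<longleftrightarrow> idx m < idx n" for m n
    using mono[of m n] mono[of n m] assms by (metis injD linorder_neqE_nat order_less_asym order_less_irrefl)
  have "inj rk"
    using iff assms by (metis injD injI linorder_neqE_nat order_less_irrefl)
  moreover have "rk ` UNIV \<subseteq> {..<card (UNIV :: 'n set)}"
  proof -
    have "rk n < card (UNIV :: 'n set)" for n
      unfolding rk_def by (rule psubset_card_mono) auto
    then show ?thesis by auto
  qed
  ultimately have "bij_betw rk UNIV {..<card (UNIV :: 'n set)}"
    unfolding bij_betw_def by (intro conjI card_subset_eq) (auto simp: card_image)
  then show ?thesis using iff by blast
qed

lemma unitary_cancel:
  assumes "unitary_mat U" "\<And>a. (\<Sum>n\<in>UNIV. U a n * y n) = 0"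
  shows "y m = 0"
proof -
  have "(\<Sum>n\<in>UNIV. mmul (adj U) U m n * y n) = (\<Sum>a\<in>UNIV. adj U m a * (\<Sum>n\<in>UNIV. U a n * y n))"
    unfolding mmul_def sum_distrib_left sum_distrib_right
    by (subst sum.swap) (simp add: mult.assoc)
  then show ?thesis
    using assms by (simp add: unitary_mat_iff idm_def if_distrib[of "\<lambda>z. z * _"] cong: if_cong)
qed

lemma proj_state_scale:
  assumes "c \<noteq> 0"
  shows "proj_state (\<lambda>f. c * v f) = proj_state v"
proof (intro ext)
  fix a b
  let ?S = "complex_of_real (\<Sum>f\<in>UNIV. (cmod (v f))\<^sup>2)"
  have "complex_of_real (\<Sum>f\<in>UNIV. (cmod (c * v f))\<^sup>2) = (c * cnj c) * ?S"
    by (simp only: norm_mult power_mult_distrib of_real_mult complex_norm_square flip: sum_distrib_left)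
  then have "proj_state (\<lambda>f. c * v f) a b = ((c * cnj c) * (v a * cnj (v b))) / ((c * cnj c) * ?S)"
    by (simp add: proj_state_def ac_simps)
  also have "\<dots> = proj_state v a b"
    using assms by (simp add: proj_state_def)
  finally show "proj_state (\<lambda>f. c * v f) a b = proj_state v a b" .
qed

section \<open>Highest-weight vectors from basis vectors, and their translates by unitaries\<close>

context tableau
begin

abbreviation highest_vector :: "('n \<Rightarrow> nat) \<Rightarrow> ('k, 'n) tensor" where
  "highest_vector rk \<equiv> young_pi row col (row_tensor row (rank_basis rk))"

text \<open>An upper triangular matrix sends the basis vector of rank \<open>i\<close> into the span
  of those of rank at most \<open>i\<close>, so the triangular lemma applies.\<close>

lemma highest_vector_upper:
  fixes rk :: "'n::finite \<Rightarrow> nat"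
  assumes "inj rk" "upper rk g"
  shows "\<exists>c. tensor_power_act g (highest_vector rk) = (\<lambda>f. c * highest_vector rk f)"
proof -
  define y where "y i a = (\<Sum>c\<in>UNIV. g a c * rank_basis rk i c)" for i a
  \<comment> \<open>The sum has at most one nonzero term, as \<open>rk\<close> is injective; it
    reads off the coordinate of rank \<open>j\<close> and gives 0 if there is none.\<close>
  define A where "A i j = (\<Sum>a\<in>UNIV. if rk a = j then y i a else 0)" for i j
  have A: "A i (rk a) = y i a" for i a
    unfolding A_def using assms(1) by (simp add: inj_eq)
  have low: "y i a = 0" if "i < rk a" for i a
    unfolding y_def by (rule sum.neutral) (use that assms(2) in \<open>auto simp: rank_basis_def upper_def\<close>)
  have "y i a = (\<Sum>j\<le>i. A i j * rank_basis rk j a)" for i a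
  proof -
    have "(\<Sum>j\<le>i. A i j * rank_basis rk j a) = (\<Sum>j\<le>i. if j = rk a then A i (rk a) else 0)"
      by (rule sum.cong) (auto simp: rank_basis_def)
    then show ?thesis using A low[of i a] by auto
  qed
  then have "young_pi row col (row_tensor row y)
      = (\<lambda>f. (\<Prod>b\<in>UNIV. A (row b) (row b)) * highest_vector rk f)"
    by (rule young_pi_row_tensor_triangular)
  moreover have "tensor_power_act g (highest_vector rk) = young_pi row col (row_tensor row y)"
    by (simp add: tensor_power_act_young_pi tensor_power_act_row_tensor y_def[abs_def])
  ultimately show ?thesis by auto
qed

text \<open>At the row filling only \<open>q = id\<close> survives antisymmetrization, since any
  other column permutation moves some box to another row.\<close>

lemma highest_vector_nonzero:
  fixes rk :: "'n::finite \<Rightarrow> nat"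
  assumes g: "\<And>b. rk (g b) = row b"
  shows "highest_vector rk g \<noteq> 0"
proof -
  have "colsym col (row_tensor row (rank_basis rk)) g = (\<Sum>q\<in>row_group col. if q = id then 1 else 0)"
    unfolding colsym_def
  proof (rule sum.cong[OF refl])
    fix q assume q: "q \<in> row_group col"
    show "of_int (sign q) * row_tensor row (rank_basis rk) (g \<circ> q) = (if q = id then 1 else 0)"
    proof (cases "q = id")
      case True
      then show ?thesis by (simp add: row_tensor_def rank_basis_def g)
    next
      case False
      then have "q \<notin> row_group row" using q row_col_group_Int by blast
      then obtain b where "row (q b) \<noteq> row b" using row_groupD[OF q] by (auto simp: row_group_def)
      then have "row_tensor row (rank_basis rk) (g \<circ> q) = 0"
        unfolding row_tensor_def by (intro prod_zero) (auto simp: rank_basis_def g)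
      then show ?thesis using False by simp
    qed
  qed
  then have "colsym col (row_tensor row (rank_basis rk)) g = 1"
    by (simp add: id_in_row_group)
  moreover have "card (row_group row) \<noteq> 0"
    using id_in_row_group[of row] by (auto simp: card_eq_0_iff)
  ultimately show ?thesis using young_mu_pos by (simp add: young_pi_row_tensor)
qed

text \<open>Subtracting a multiple of \<open>highest_vector rk\<close> cancels the coefficient at
  the row filling, and \<open>raising_killed_H_alpha\<close> then forces the difference to be zero.
  The argument runs through \<open>raising_killed\<close> because, unlike stability of a line, it is
  a linear condition.\<close>

lemma highest_vector_unique:
  fixes v :: "('k, 'n::finite) tensor"
  assumes rk: "bij_betw rk UNIV {..<card (UNIV :: 'n set)}"
    and v: "v \<in> H_alpha row col" "v \<noteq> (\<lambda>_. 0)" "borel_line rk v"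
  shows "r \<le> card (UNIV :: 'n set) \<and> (\<exists>c. c \<noteq> 0 \<and> v = (\<lambda>f. c * highest_vector rk f))"
proof -
  have inj: "inj rk" using rk by (auto simp: bij_betw_def)
  obtain g where g: "v g \<noteq> 0" "\<And>b. rk (g b) = row b"
    using raising_killed_H_alpha[OF rk v(1,2) borel_line_raising_killed[OF v(3)]] by blast
  have Eg: "highest_vector rk g \<noteq> 0" using g(2) by (rule highest_vector_nonzero)
  define c where "c = v g / highest_vector rk g"
  have "borel_line rk (highest_vector rk)"
    unfolding borel_line_def using highest_vector_upper[OF inj] by blast
  then have "raising_killed rk (\<lambda>f. v f + (- c) * highest_vector rk f)"
    by (intro raising_killed_add_scale borel_line_raising_killed v(3))
  moreover have "(\<lambda>f. v f + (- c) * highest_vector rk f) \<in> H_alpha row col"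
    by (intro H_alpha_add H_alpha_scale v(1) young_pi_in_H_alpha)
  moreover have "v h + (- c) * highest_vector rk h = 0" if "\<forall>b. rk (h b) = row b" for h
  proof -
    have "h = g" using that g(2) inj by (metis ext injD)
    then show ?thesis using Eg by (simp add: c_def)
  qed
  ultimately have "(\<lambda>f. v f + (- c) * highest_vector rk f) = (\<lambda>_. 0)"
    using raising_killed_H_alpha[OF rk] by blast
  then have "v = (\<lambda>f. c * highest_vector rk f)"
    by (simp add: fun_eq_iff)
  moreover have "c \<noteq> 0" using g(1) Eg by (simp add: c_def)
  moreover have "r \<le> card (UNIV :: 'n set)"
  proof (rule ccontr)
    assume "\<not> ?thesis"
    then obtain b where "row b = card (UNIV :: 'n set)" using row_exists by (meson not_le)
    then have "rk (g b) = card (UNIV :: 'n set)" using g(2) by simp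
    moreover have "rk (g b) < card (UNIV :: 'n set)" using rk by (auto simp: bij_betw_def)
    ultimately show False by simp
  qed
  ultimately show ?thesis by blast
qed

text \<open>Applying the adjoint of \<open>U\<close> reduces to the standard basis, where
  \<open>highest_vector_unique\<close> applies; transporting back yields the row tensor of columns
  of \<open>U\<close>.\<close>

lemma alpha_simple_imp_segre:
  fixes v :: "('k, 'n::finite) tensor"
  assumes "alpha_simple row col v"
  shows "\<exists>x c. wedge_nonzero r x \<and> c \<noteq> 0 \<and> v = (\<lambda>f. c * young_pi row col (row_tensor row x) f)"
proof -
  obtain U idx where v: "v \<in> H_alpha row col" "v \<noteq> (\<lambda>_. 0)" and U: "unitary_mat U" and "inj idx"
    and line: "\<And>g. borel_elem U idx g \<Longrightarrow> \<exists>c. tensor_power_act g v = (\<lambda>f. c * v f)"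
    using assms by (auto simp: alpha_simple_def)
  obtain rk where rk: "bij_betw rk UNIV {..<card (UNIV :: 'n set)}"
    and ord: "\<And>m n. rk m < rk n \<longleftrightarrow> idx m < idx n"
    using inj_rank[OF \<open>inj idx\<close>] by blast
  have UU: "mmul U (adj U) = idm" "mmul (adj U) U = idm" using U by (auto simp: unitary_mat_iff)
  define w where "w = tensor_power_act (adj U) v"
  have vw: "v = tensor_power_act U w"
    by (simp add: w_def tensor_power_act_mmul UU)
  have "w \<noteq> (\<lambda>_. 0)"
  proof
    assume "w = (\<lambda>_. 0)"
    then have "v = (\<lambda>_. 0)" by (subst vw) (simp add: tensor_power_act_def)
    then show False using v(2) by simp
  qed
  moreover have "w \<in> H_alpha row col" unfolding w_def using v(1) by (rule tensor_power_act_H_alpha)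
  moreover have "borel_line rk w"
    unfolding borel_line_def
  proof (intro allI impI)
    fix g assume "invertible_mat g" and up: "upper rk g"
    then obtain h where h: "mmul g h = idm" "mmul h g = idm" by (auto simp: invertible_mat_iff)
    \<comment> \<open>The conjugate of \<open>g\<close> lies in the Borel subgroup of
      \<open>U\<close>, so the stability of the line of \<open>v\<close> transfers to
      \<open>w\<close>.\<close>
    define g' where "g' = mmul U (mmul g (adj U))"
    have canc: "mmul (adj U) (mmul U k) = k" "mmul g (mmul h k) = k" "mmul h (mmul g k) = k" for k
      by (simp_all add: UU h flip: mmul_assoc)
    have "mmul g' (mmul U (mmul h (adj U))) = idm" "mmul (mmul U (mmul h (adj U))) g' = idm"
      by (simp_all add: g'_def mmul_assoc canc UU)
    then have "invertible_mat g'" unfolding invertible_mat_iff by blast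
    moreover have "mmul (adj U) (mmul g' U) = g"
      by (simp add: g'_def mmul_assoc canc UU)
    ultimately have "borel_elem U idx g'" using up by (simp add: borel_elem_iff upper_def ord)
    then obtain c where c: "tensor_power_act g' v = (\<lambda>f. c * v f)" using line by blast
    have "mmul g (adj U) = mmul (adj U) g'" by (simp add: g'_def canc)
    then have "tensor_power_act g w = tensor_power_act (adj U) (tensor_power_act g' v)"
      by (simp add: w_def tensor_power_act_mmul)
    then have "tensor_power_act g w = (\<lambda>f. c * w f)"
      by (simp add: c tensor_power_act_scale w_def)
    then show "\<exists>c. tensor_power_act g w = (\<lambda>f. c * w f)" by blast
  qed
  ultimately obtain c where r: "r \<le> card (UNIV :: 'n set)" and c: "c \<noteq> 0"
    and w: "w = (\<lambda>f. c * highest_vector rk f)"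
    using highest_vector_unique[OF rk] by blast
  define x where "x i a = (\<Sum>n\<in>UNIV. U a n * rank_basis rk i n)" for i a
  have "wedge_nonzero r x"
    unfolding wedge_nonzero_def
  proof (intro allI impI)
    fix e i assume e: "\<forall>a. (\<Sum>i<r. e i * x i a) = 0" and i: "i < r"
    have "(\<Sum>n\<in>UNIV. U a n * (\<Sum>i<r. e i * rank_basis rk i n)) = 0" for a
    proof -
      have "(\<Sum>n\<in>UNIV. U a n * (\<Sum>i<r. e i * rank_basis rk i n)) = (\<Sum>i<r. e i * x i a)"
        unfolding x_def sum_distrib_left by (subst sum.swap) (simp add: mult.left_commute)
      then show ?thesis using e by simp
    qed
    then have z: "(\<Sum>i<r. e i * rank_basis rk i n) = 0" for n
      by (rule unitary_cancel[OF U])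
    have "i \<in> rk ` UNIV" using i r rk by (auto simp: bij_betw_def)
    then obtain n where n: "rk n = i" by auto
    have "(\<Sum>j<r. e j * rank_basis rk j n) = (\<Sum>j<r. if j = i then e i else 0)"
      by (rule sum.cong) (auto simp: rank_basis_def n)
    then show "e i = 0" using z[of n] i by simp
  qed
  moreover have "v = (\<lambda>f. c * young_pi row col (row_tensor row x) f)"
    by (subst vw) (simp add: w tensor_power_act_scale tensor_power_act_young_pi tensor_power_act_row_tensor x_def[abs_def])
  ultimately show ?thesis using c by blast
qed

text \<open>Gram-Schmidt changes the row tensor only by the nonzero scalar \<open>P\<close> under
  \<open>young_pi\<close>, and the resulting orthonormal vectors are the images of basis vectors
  under a unitary. The Borel subgroup of that unitary fixes the line.\<close>

lemma segre_alpha_simple: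
  fixes x :: "nat \<Rightarrow> 'n::finite \<Rightarrow> complex"
  assumes x: "wedge_nonzero r x"
  shows "alpha_simple row col (young_pi row col (row_tensor row x))"
proof -
  obtain rk where rk: "bij_betw rk (UNIV :: 'n set) {..<card (UNIV :: 'n set)}"
    using ex_bij_betw_finite_nat[of "UNIV :: 'n set"] by (auto simp: atLeast0LessThan)
  have inj: "inj rk" using rk by (auto simp: bij_betw_def)
  obtain u A where r: "r \<le> card (UNIV :: 'n set)" and U: "unitary_mat (\<lambda>a n. u (rk n) a)"
    and A: "\<And>i. i < r \<Longrightarrow> A i i \<noteq> 0" "\<And>i a. i < r \<Longrightarrow> x i a = (\<Sum>j\<le>i. A i j * u j a)"
    using unitary_flag[OF x rk] by blast
  let ?U = "\<lambda>a n. u (rk n) a"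
  have UU: "mmul ?U (adj ?U) = idm" "mmul (adj ?U) ?U = idm" using U by (auto simp: unitary_mat_iff)
  have surj: "\<exists>n. rk n = i" if "i < r" for i
  proof -
    have "i \<in> rk ` UNIV" using rk r that by (auto simp: bij_betw_def)
    then show ?thesis by auto
  qed
  define P where "P = (\<Prod>b\<in>UNIV. A (row b) (row b))"
  have P: "P \<noteq> 0" using A(1) row_less by (simp add: P_def)
  let ?E = "highest_vector rk" and ?v = "young_pi row col (row_tensor row x)"
  have "row_tensor row u = row_tensor row (\<lambda>i a. \<Sum>n\<in>UNIV. ?U a n * rank_basis rk i n)"
  proof -
    have "(\<Sum>n\<in>UNIV. ?U a n * rank_basis rk i n) = u i a" if i: "i < r" for i a
    proof -
      obtain m where m: "rk m = i" using surj[OF i] by blast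
      have "(\<Sum>n\<in>UNIV. ?U a n * rank_basis rk i n) = (\<Sum>n\<in>UNIV. if n = m then u i a else 0)"
        by (rule sum.cong) (use m inj in \<open>auto simp: rank_basis_def inj_eq\<close>)
      then show ?thesis by simp
    qed
    then show ?thesis by (simp add: row_tensor_def row_less)
  qed
  then have "young_pi row col (row_tensor row u) = tensor_power_act ?U ?E"
    by (simp add: tensor_power_act_young_pi tensor_power_act_row_tensor)
  moreover have "?v = (\<lambda>f. P * young_pi row col (row_tensor row u) f)"
    unfolding P_def using A(2) by (rule young_pi_row_tensor_triangular)
  ultimately have v: "?v = (\<lambda>f. P * tensor_power_act ?U ?E f)" by simp
  have nz: "?v \<noteq> (\<lambda>_. 0)"
  proof
    assume "?v = (\<lambda>_. 0)"
    then have "tensor_power_act ?U ?E = (\<lambda>_. 0)" using P v by (simp add: fun_eq_iff)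
    then have "tensor_power_act (adj ?U) (tensor_power_act ?U ?E) = (\<lambda>_. 0)"
      by (simp add: tensor_power_act_def)
    then have "?E = (\<lambda>_. 0)" by (simp add: tensor_power_act_mmul UU)
    moreover have "\<forall>b. \<exists>n. rk n = row b" using surj row_less by blast
    then have "\<exists>g. \<forall>b. rk (g b) = row b" by (rule choice)
    then obtain g where "\<And>b. rk (g b) = row b" by blast
    then have "highest_vector rk g \<noteq> 0" by (rule highest_vector_nonzero)
    ultimately show False by simp
  qed
  have "\<exists>c. tensor_power_act g ?v = (\<lambda>f. c * ?v f)" if g: "borel_elem ?U rk g" for g
  proof -
    let ?g = "mmul (adj ?U) (mmul g ?U)"
    obtain c where c: "tensor_power_act ?g ?E = (\<lambda>f. c * ?E f)"
      using g highest_vector_upper[OF inj] unfolding borel_elem_iff by blast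
    have "mmul g ?U = mmul ?U ?g" by (simp add: UU flip: mmul_assoc)
    then have "tensor_power_act g (tensor_power_act ?U ?E) = tensor_power_act ?U (tensor_power_act ?g ?E)"
      by (simp add: tensor_power_act_mmul)
    also have "\<dots> = (\<lambda>f. c * tensor_power_act ?U ?E f)"
      by (simp only: c tensor_power_act_scale)
    finally have "tensor_power_act g ?v = (\<lambda>f. c * ?v f)"
      unfolding v tensor_power_act_scale by (simp add: mult.left_commute)
    then show ?thesis by blast
  qed
  then show ?thesis
    unfolding alpha_simple_def using U inj nz young_pi_in_H_alpha by blast
qed

lemma simple_pure_state_iff_seg_range:
  fixes \<rho> :: "('k, 'n::finite) kernel"
  shows "simple_pure_state row col \<rho> \<longleftrightarrow> \<rho> \<in> seg_range r row col"
proof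
  assume "simple_pure_state row col \<rho>"
  then obtain v where "alpha_simple row col v" and \<rho>: "\<rho> = proj_state v"
    by (auto simp: simple_pure_state_def)
  then obtain x c where x: "wedge_nonzero r x" "c \<noteq> 0"
    and "v = (\<lambda>f. c * young_pi row col (row_tensor row x) f)"
    using alpha_simple_imp_segre by blast
  then have "\<rho> = proj_state (young_pi row col (row_tensor row x))"
    by (simp add: \<rho> proj_state_scale)
  then show "\<rho> \<in> seg_range r row col" using x(1) by (auto simp: seg_range_def)
next
  assume "\<rho> \<in> seg_range r row col"
  then show "simple_pure_state row col \<rho>"
    using segre_alpha_simple by (auto simp: seg_range_def simple_pure_state_def)
qed

end

section \<open>Pure states, density operators and convex combinations\<close>

lemma proj_state_form:
  "(\<Sum>a\<in>UNIV. \<Sum>b\<in>UNIV. cnj (T a) * proj_state v a b * T b)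
    = of_real ((cmod (\<Sum>a\<in>UNIV. cnj (T a) * v a))\<^sup>2 / (\<Sum>c\<in>UNIV. (cmod (v c))\<^sup>2))"
proof -
  let ?w = "\<Sum>a\<in>UNIV. cnj (T a) * v a" and ?S = "complex_of_real (\<Sum>c\<in>UNIV. (cmod (v c))\<^sup>2)"
  have "cnj (T a) * proj_state v a b * T b = (cnj (T a) * v a) * cnj (cnj (T b) * v b) / ?S" for a b
    by (simp add: proj_state_def ac_simps)
  then have "(\<Sum>a\<in>UNIV. \<Sum>b\<in>UNIV. cnj (T a) * proj_state v a b * T b)
      = (\<Sum>a\<in>UNIV. \<Sum>b\<in>UNIV. (cnj (T a) * v a) * cnj (cnj (T b) * v b)) / ?S"
    by (simp only: sum_divide_distrib)
  also have "\<dots> = ?w * cnj ?w / ?S" by (simp only: sum_product cnj_sum)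
  also have "\<dots> = of_real ((cmod ?w)\<^sup>2 / (\<Sum>c\<in>UNIV. (cmod (v c))\<^sup>2))"
    by (simp only: of_real_divide complex_norm_square)
  finally show ?thesis .
qed

lemma trace_proj_state:
  assumes "v \<noteq> (\<lambda>_. 0)"
  shows "(\<Sum>a\<in>UNIV. proj_state v a a) = 1"
proof -
  have "(\<Sum>a\<in>UNIV. proj_state v a a)
      = (\<Sum>a\<in>UNIV. cnj (v a) * v a) / of_real (\<Sum>c\<in>UNIV. (cmod (v c))\<^sup>2)"
    by (simp only: proj_state_def sum_divide_distrib mult.commute)
  moreover have "complex_of_real (\<Sum>c\<in>UNIV. (cmod (v c))\<^sup>2) \<noteq> 0"
    using sum_cmod_pos[OF assms] by (simp only: of_real_eq_0_iff)
  ultimately show ?thesis unfolding sum_cnj_self by (metis divide_self)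
qed

lemma conv_ops_mono:
  assumes "A \<subseteq> B" shows "conv_ops A \<subseteq> conv_ops B"
proof
  fix K assume "K \<in> conv_ops A"
  then obtain m :: nat and t \<rho> where "\<forall>i<m. 0 \<le> t i \<and> \<rho> i \<in> A" "(\<Sum>i<m. t i) = 1"
    "K = (\<lambda>a b. \<Sum>i<m. complex_of_real (t i) * \<rho> i a b)"
    unfolding conv_ops_def mem_Collect_eq by blast
  then show "K \<in> conv_ops B"
    unfolding conv_ops_def mem_Collect_eq using assms by (intro exI[of _ m] exI[of _ t] exI[of _ \<rho>]) auto
qed

text \<open>Membership in \<open>density_alpha\<close>, which \<open>simple_mixed\<close> demands,
  is checked here for convex combinations: the quadratic form is a nonnegative combination of
  squared moduli, and each column is a combination of the vectors \<open>v i\<close>.\<close>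

lemma conv_ops_pure_subset_density:
  "conv_ops {\<rho> :: ('k::finite, 'n::finite) kernel. pure_alpha_state row col \<rho>} \<subseteq> density_alpha row col"
proof
  fix K :: "('k, 'n) kernel" assume "K \<in> conv_ops {\<rho>. pure_alpha_state row col \<rho>}"
  then obtain m :: nat and t \<rho> where t: "\<And>i. i < m \<Longrightarrow> 0 \<le> t i" and \<rho>: "\<And>i. i < m \<Longrightarrow> pure_alpha_state row col (\<rho> i)"
    and t1: "(\<Sum>i<m. t i) = 1" and K: "K = (\<lambda>a b. \<Sum>i<m. of_real (t i) * \<rho> i a b)"
    unfolding conv_ops_def mem_Collect_eq by blast
  have "\<forall>i. \<exists>v. i < m \<longrightarrow> v \<in> H_alpha row col \<and> v \<noteq> (\<lambda>_. 0) \<and> \<rho> i = proj_state v"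
    using \<rho> by (auto simp: pure_alpha_state_def)
  then obtain v where v: "\<And>i. i < m \<Longrightarrow> v i \<in> H_alpha row col \<and> v i \<noteq> (\<lambda>_. 0) \<and> \<rho> i = proj_state (v i)"
    by metis
  have form: "(\<Sum>a\<in>UNIV. \<Sum>b\<in>UNIV. cnj (T a) * K a b * T b) = of_real (\<Sum>i<m. t i *
      ((cmod (\<Sum>a\<in>UNIV. cnj (T a) * v i a))\<^sup>2 / (\<Sum>c\<in>UNIV. (cmod (v i c))\<^sup>2)))" for T
  proof -
    have "(\<Sum>a\<in>UNIV. \<Sum>b\<in>UNIV. cnj (T a) * K a b * T b)
        = (\<Sum>a\<in>UNIV. \<Sum>b\<in>UNIV. \<Sum>i<m. of_real (t i) * (cnj (T a) * \<rho> i a b * T b))"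
      by (simp add: K sum_distrib_left sum_distrib_right ac_simps)
    also have "\<dots> = (\<Sum>i<m. \<Sum>a\<in>UNIV. \<Sum>b\<in>UNIV. of_real (t i) * (cnj (T a) * \<rho> i a b * T b))"
      by (rule trans[OF sum.cong[OF refl sum.swap] sum.swap])
    also have "\<dots> = (\<Sum>i<m. of_real (t i) * (\<Sum>a\<in>UNIV. \<Sum>b\<in>UNIV. cnj (T a) * proj_state (v i) a b * T b))"
      by (rule sum.cong[OF refl]) (simp add: v sum_distrib_left)
    finally show ?thesis by (simp only: proj_state_form of_real_sum of_real_mult)
  qed
  have pos: "0 \<le> (\<Sum>i<m. t i * ((cmod (\<Sum>a\<in>UNIV. cnj (T a) * v i a))\<^sup>2 / (\<Sum>c\<in>UNIV. (cmod (v i c))\<^sup>2)))" for T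
    by (intro sum_nonneg mult_nonneg_nonneg divide_nonneg_nonneg t) auto
  have "(\<Sum>a\<in>UNIV. K a a) = (\<Sum>i<m. of_real (t i) * (\<Sum>a\<in>UNIV. \<rho> i a a))"
    unfolding K sum_distrib_left by (rule sum.swap)
  also have "\<dots> = (\<Sum>i<m. of_real (t i))"
    by (rule sum.cong[OF refl]) (simp add: v trace_proj_state)
  also have "\<dots> = 1" using t1 by (simp flip: of_real_sum)
  finally have tr: "(\<Sum>a\<in>UNIV. K a a) = 1" .
  have "(\<lambda>a. K a b) \<in> H_alpha row col" for b
    unfolding K
  proof (rule H_alpha_sum)
    fix i assume "i \<in> {..<m}"
    then have i: "v i \<in> H_alpha row col" "\<rho> i = proj_state (v i)" using v by auto
    have "(\<lambda>a. of_real (t i) * \<rho> i a b)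
        = (\<lambda>a. (of_real (t i) * cnj (v i b) / of_real (\<Sum>c\<in>UNIV. (cmod (v i c))\<^sup>2)) * v i a)"
      by (simp add: i(2) proj_state_def ac_simps)
    then show "(\<lambda>a. of_real (t i) * \<rho> i a b) \<in> H_alpha row col"
      by (simp only: H_alpha_scale[OF i(1)])
  qed
  then show "K \<in> density_alpha row col"
    unfolding density_alpha_def using tr pos by (simp only: form mem_Collect_eq Re_complex_of_real Im_complex_of_real) simp
qed

theorem mainTheorem4:
  fixes r :: nat and lam :: "nat \<Rightarrow> nat" and row col :: "'k::finite \<Rightarrow> nat"
  assumes "young_tableau r lam row col"
  shows "(\<forall>\<rho> :: ('k, 'n::finite) kernel. pure_alpha_state row col \<rho> \<longrightarrow>
            (entangled_pure_state row col \<rho> \<longleftrightarrow> \<rho> \<notin> seg_range r row col))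
       \<and> (simple_mixed row col :: ('k, 'n) kernel set) = conv_ops (seg_range r row col)
       \<and> (entangled_mixed row col :: ('k, 'n) kernel set) = density_alpha row col - simple_mixed row col"
proof -
  interpret tableau r lam row col using assms by unfold_locales
  have seg: "{\<rho> :: ('k, 'n) kernel. simple_pure_state row col \<rho>} = seg_range r row col"
    by (simp add: simple_pure_state_iff_seg_range)
  have "(seg_range r row col :: ('k, 'n) kernel set) \<subseteq> {\<rho>. pure_alpha_state row col \<rho>}"
    unfolding seg[symmetric] by (auto simp: simple_pure_state_def alpha_simple_def pure_alpha_state_def)
  then have "conv_ops (seg_range r row col :: ('k, 'n) kernel set) \<subseteq> conv_ops {\<rho>. pure_alpha_state row col \<rho>}"
    by (rule conv_ops_mono)
  then have "conv_ops (seg_range r row col :: ('k, 'n) kernel set) \<subseteq> density_alpha row col"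
    using conv_ops_pure_subset_density by blast
  then show ?thesis
    by (auto simp: entangled_pure_state_def simple_pure_state_iff_seg_range simple_mixed_def
        entangled_mixed_def seg)
qed

end
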